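(* Let $\alpha,\beta\in(0,1)$ with $\alpha\neq\beta$. Then $E(T_{\alpha},(t_n^{\alpha}))$ and $E(T_{\beta},(t_n^{\beta}))$ are incompatible among all Schauder equivalence relations; that is, there is no Schauder equivalence relation $R$ such that both $R\leq_B E(T_{\alpha},(t_n^{\alpha}))$ and $R\leq_B E(T_{\beta},(t_n^{\beta}))$.
   Context: $\mathbb{N}=\{0,1,2,\ldots\}$; Banach spaces are over $\mathbb{R}$. For a basic sequence $\{x_n\}$ in a Banach space $X$ (a Schauder basis, indexed by $\mathbb{N}$, of its closed linear span), $\mathrm{coef}(X,(x_n))$ is the set of all $a=(a_n)\in\mathbb{R}^{\mathbb{N}}$ such that $\sum_n a_nx_n$ converges in $X$, and $E(X,(x_n))$ is the (Borel) equivalence relation on $\mathbb{R}^{\mathbb{N}}$ given by $(x,y)\in E(X,(x_n)) \iff x-y\in \mathrm{coef}(X,(x_n))$. The Schauder equivalence relations are all the equivalence relations of the form $E(X,(x_n))$ with $X$ a Banach space and $\{x_n\}$ a basic sequence in $X$. For equivalence relations $E,F$ on Polish spaces $P,Q$, $E\leq_B F$ means that there is a Borel $\theta:P\to Q$ with $xEy\iff\theta(x)F\theta(y)$ for all $x,y\in P$. Two equivalence relations $E,F$ in a class $\mathcal{C}$ are compatible (in $\mathcal{C}$) if there is $R\in\mathcal{C}$ with $R\leq_B E$ and $R\leq_B F$; otherwise they are incompatible. Spaces $T_\alpha$: for finite nonempty sets $E,F$ of natural numbers, $E<F$ means $\max E<\min F$, and $k\leq E$ means $k\leq\min E$. For $x=(a_n)\in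 c_{00}$ (eventually zero real sequences), $Ex$ denotes the sequence agreeing with $x$ on $E$ and $0$ elsewhere. For $\alpha\in(0,1)$ define norms on $c_{00}$ by $\|x\|_0=\max_n|a_n|$ and, for $m\ge 0$, $$\|x\|_{m+1}=\max\Big\{\|x\|_m,\ \alpha\cdot\max\Big[\sum_{j=1}^k\|E_jx\|_m\Big]\Big\},$$ where the inner max is over all $k$ and all choices of finite subsets $E_1,\ldots,E_k$ of $\mathbb{N}$ with $k\leq E_1<E_2<\cdots<E_k$. Then $\|x\|=\lim_m\|x\|_m$ is a norm on $c_{00}$, $T_\alpha$ is the completion of $c_{00}$ in this norm, and $\{t_n^\alpha\}$ is the sequence of unit vectors, which is a basis of $T_\alpha$. *)

theory Defs
  imports "HOL-Analysis.Analysis" "HOL-Probability.Discrete_Topology"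
begin

section \<open>Borel reducibility and compatibility\<close>

definition borel_reducible ::
    "('a::polish_space \<times> 'a) set \<Rightarrow> ('b::polish_space \<times> 'b) set \<Rightarrow> bool" (infix \<open>\<le>\<^sub>B\<close> 50) where
  "E \<le>\<^sub>B F \<longleftrightarrow>
    (\<exists>\<theta> \<in> borel_measurable borel. \<forall>x y. (x, y) \<in> E \<longleftrightarrow> (\<theta> x, \<theta> y) \<in> F)"

definition compatible ::
    "('a::polish_space \<times> 'a) set set \<Rightarrow> ('b::polish_space \<times> 'b) set \<Rightarrow> ('c::polish_space \<times> 'c) set \<Rightarrow> bool" where
  "compatible \<C> E F \<longleftrightarrow> (\<exists>R \<in> \<C>. R \<le>\<^sub>B E \<and> R \<le>\<^sub>B F)"

abbreviation incompatible ::
    "('a::polish_space \<times> 'a) set set \<Rightarrow> ('b::polish_space \<times> 'b) set \<Rightarrow> ('c::polish_space \<times> 'c) set \<Rightarrow> bool" where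
  "incompatible \<C> E F \<equiv> \<not> compatible \<C> E F"


section \<open>Schauder equivalence relations\<close>

text \<open>
  Throughout, a Banach space is a closed linear subspace \<open>X\<close> of a type of class
  \<^class>\<open>banach\<close> (so \<open>X = UNIV\<close> is the type itself). Subspaces are needed because the spaces
  \<open>T_space \<alpha>\<close> below depend on a real number, which a type cannot.
\<close>

definition banach_subspace :: "'a::banach set \<Rightarrow> bool" where
  "banach_subspace X \<longleftrightarrow> subspace X \<and> closed X"

definition schauder_basis :: "'a::banach set \<Rightarrow> (nat \<Rightarrow> 'a) \<Rightarrow> bool" where
  "schauder_basis X x \<longleftrightarrow>
    range x \<subseteq> X \<and> (\<forall>z\<in>X. \<exists>!a :: nat \<Rightarrow> real. (\<lambda>n. a n *\<^sub>R x n) sums z)"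

definition basic_sequence :: "'a::banach set \<Rightarrow> (nat \<Rightarrow> 'a) \<Rightarrow> bool" where
  "basic_sequence X x \<longleftrightarrow> range x \<subseteq> X \<and> schauder_basis (closure (span (range x))) x"

definition coef :: "'a::banach set \<Rightarrow> (nat \<Rightarrow> 'a) \<Rightarrow> (nat \<Rightarrow> real) set" where
  "coef X x = {a. \<exists>z\<in>X. (\<lambda>n. a n *\<^sub>R x n) sums z}"

definition schauder_er ::
    "'a::banach set \<Rightarrow> (nat \<Rightarrow> 'a) \<Rightarrow> ((nat \<Rightarrow> real) \<times> (nat \<Rightarrow> real)) set" where
  "schauder_er X x = {(a, b). (\<lambda>n. a n - b n) \<in> coef X x}"

text \<open>
  The Schauder equivalence relations coming from Banach spaces inside the type \<open>'a\<close>; a theorem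
  that is polymorphic in \<open>'a\<close> speaks about all of them.
\<close>

definition schauder_ers :: "'a::banach itself \<Rightarrow> ((nat \<Rightarrow> real) \<times> (nat \<Rightarrow> real)) set set" where
  "schauder_ers _ =
    {schauder_er X x | (X :: 'a set) x. banach_subspace X \<and> basic_sequence X x}"


section \<open>The norm of \<open>T\<^sub>\<alpha>\<close> on \<open>c\<^sub>0\<^sub>0\<close>\<close>

definition c00 :: "(nat \<Rightarrow> real) set" where
  "c00 = {x. finite {n. x n \<noteq> 0}}"

definition proj :: "nat set \<Rightarrow> (nat \<Rightarrow> real) \<Rightarrow> nat \<Rightarrow> real" where
  "proj A x = (\<lambda>n. if n \<in> A then x n else 0)"

text \<open>
  The families \<open>k \<le> E\<^sub>1 < \<dots> < E\<^sub>k\<close> of finite nonempty sets, indexed from \<open>0\<close>; the values of \<open>E\<close>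
  at indices \<open>\<ge> k\<close> are irrelevant.
\<close>

definition admissible :: "(nat \<times> (nat \<Rightarrow> nat set)) set" where
  "admissible = {(k, E). 1 \<le> k \<and> (\<forall>j<k. finite (E j) \<and> E j \<noteq> {}) \<and>
      k \<le> Min (E 0) \<and> (\<forall>j. Suc j < k \<longrightarrow> Max (E j) < Min (E (Suc j)))}"

text \<open>For \<open>x\<close> in \<^const>\<open>c00\<close> the suprema range over finite sets of values, so they are maxima.\<close>

primrec tnorm_step :: "real \<Rightarrow> nat \<Rightarrow> (nat \<Rightarrow> real) \<Rightarrow> real" where
  "tnorm_step \<alpha> 0 x = (SUP n. \<bar>x n\<bar>)"
| "tnorm_step \<alpha> (Suc m) x =
    max (tnorm_step \<alpha> m x)
        (\<alpha> * (SUP (k, E) \<in> admissible. \<Sum>j<k. tnorm_step \<alpha> m (proj (E j) x)))"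

definition tnorm :: "real \<Rightarrow> (nat \<Rightarrow> real) \<Rightarrow> real" where
  "tnorm \<alpha> x = lim (\<lambda>m. tnorm_step \<alpha> m x)"


section \<open>The completion \<open>T\<^sub>\<alpha>\<close>\<close>

text \<open>
  The completion of \<^const>\<open>c00\<close> is realised in the standard way, as the closure of its image under
  the canonical embedding into the bidual: \<open>x\<close> becomes the function \<open>f \<mapsto> \<langle>f, x\<rangle>\<close> on the unit
  ball of the dual of \<^const>\<open>c00\<close>, extended by \<open>0\<close> outside the ball, in a Banach space of
  bounded functions with the supremum norm (the discrete topology on the domain makes continuity
  void). That the embedding is linear and isometric on \<^const>\<open>c00\<close> is proved in
  \<open>embed_add\<close>, \<open>embed_scale\<close> and \<open>norm_embed\<close>.
\<close>

instance bcontfun :: (metric_space, banach) banach ..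

definition pairing :: "(nat \<Rightarrow> real) \<Rightarrow> (nat \<Rightarrow> real) \<Rightarrow> real" where
  "pairing f x = (\<Sum>n | x n \<noteq> 0. f n * x n)"

definition dual_ball :: "real \<Rightarrow> (nat \<Rightarrow> real) set" where
  "dual_ball \<alpha> = {f. \<forall>x\<in>c00. \<bar>pairing f x\<bar> \<le> tnorm \<alpha> x}"

definition embed :: "real \<Rightarrow> (nat \<Rightarrow> real) \<Rightarrow> (nat \<Rightarrow> real) discrete \<Rightarrow>\<^sub>C real" where
  "embed \<alpha> x = Bcontfun (\<lambda>f. if of_discrete f \<in> dual_ball \<alpha> then pairing (of_discrete f) x else 0)"

definition T_space :: "real \<Rightarrow> ((nat \<Rightarrow> real) discrete \<Rightarrow>\<^sub>C real) set" where
  "T_space \<alpha> = closure (embed \<alpha> ` c00)"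

definition t_vec :: "real \<Rightarrow> nat \<Rightarrow> (nat \<Rightarrow> real) discrete \<Rightarrow>\<^sub>C real" where
  "t_vec \<alpha> n = embed \<alpha> (\<lambda>k. if k = n then 1 else 0)"


subsection \<open>The canonical embedding is a linear isometry\<close>

lemma c00_proj: "x \<in> c00 \<Longrightarrow> proj A x \<in> c00"
  unfolding c00_def proj_def by (auto elim: finite_subset[rotated])

lemma c00_add: "x \<in> c00 \<Longrightarrow> y \<in> c00 \<Longrightarrow> (\<lambda>n. x n + y n) \<in> c00"
  unfolding c00_def
  by (auto intro: finite_subset[of _ "{n. x n \<noteq> 0} \<union> {n. y n \<noteq> 0}"])

lemma c00_scale: "x \<in> c00 \<Longrightarrow> (\<lambda>n. c * x n) \<in> c00"
  unfolding c00_def by (auto elim: finite_subset[rotated])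

lemma pairing_supset:
  assumes "finite S" "{n. x n \<noteq> 0} \<subseteq> S"
  shows "pairing f x = (\<Sum>n\<in>S. f n * x n)"
  unfolding pairing_def by (rule sum.mono_neutral_left) (use assms in auto)

lemma pairing_add:
  assumes "x \<in> c00" "y \<in> c00"
  shows "pairing f (\<lambda>n. x n + y n) = pairing f x + pairing f y"
proof -
  let ?S = "{n. x n \<noteq> 0} \<union> {n. y n \<noteq> 0}"
  have fin: "finite ?S" using assms by (auto simp: c00_def)
  have "pairing f (\<lambda>n. x n + y n) = (\<Sum>n\<in>?S. f n * (x n + y n))"
    by (rule pairing_supset[OF fin]) auto
  also have "\<dots> = (\<Sum>n\<in>?S. f n * x n) + (\<Sum>n\<in>?S. f n * y n)"
    by (simp add: distrib_left sum.distrib)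
  also have "\<dots> = pairing f x + pairing f y"
    using pairing_supset[OF fin, of x f] pairing_supset[OF fin, of y f] by auto
  finally show ?thesis .
qed

lemma pairing_scale:
  assumes "x \<in> c00"
  shows "pairing f (\<lambda>n. c * x n) = c * pairing f x"
proof -
  have "pairing f (\<lambda>n. c * x n) = (\<Sum>n | x n \<noteq> 0. f n * (c * x n))"
    by (rule pairing_supset) (use assms in \<open>auto simp: c00_def\<close>)
  then show ?thesis by (simp add: pairing_def sum_distrib_left mult_ac)
qed

definition l1 :: "(nat \<Rightarrow> real) \<Rightarrow> real" where
  "l1 x = (\<Sum>n | x n \<noteq> 0. \<bar>x n\<bar>)"

lemma admissible_less:
  assumes "(k, E) \<in> admissible" "i < j" "j < k" "a \<in> E i" "b \<in> E j"
  shows "a < b"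
  using assms(2-5)
proof (induction j arbitrary: b)
  case (Suc j)
  have *: "c < b" if "c \<in> E j" for c
  proof -
    have "c \<le> Max (E j)" "Min (E (Suc j)) \<le> b" "Max (E j) < Min (E (Suc j))"
      using assms(1) that Suc.prems by (auto simp: admissible_def)
    then show ?thesis by linarith
  qed
  have "E j \<noteq> {}" using assms(1) Suc.prems by (simp add: admissible_def)
  then obtain c where c: "c \<in> E j" by blast
  show ?case
    using * c Suc by (cases "i = j") fastforce+
qed simp

lemma admissible_disjoint:
  assumes "(k, E) \<in> admissible" "i < k" "j < k" "n \<in> E i" "n \<in> E j"
  shows "i = j"
  by (metis assms admissible_less less_irrefl linorder_neqE_nat)

lemma l1_supset:
  assumes "finite S" "{n. x n \<noteq> 0} \<subseteq> S"
  shows "l1 x = (\<Sum>n\<in>S. \<bar>x n\<bar>)"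
  unfolding l1_def by (rule sum.mono_neutral_left) (use assms in auto)

lemma l1_nonneg: "0 \<le> l1 x"
  unfolding l1_def by (simp add: sum_nonneg)

lemma sum_l1_le:
  assumes "(k, E) \<in> admissible" "x \<in> c00"
  shows "(\<Sum>j<k. l1 (proj (E j) x)) \<le> l1 x"
proof -
  let ?S = "{n. x n \<noteq> 0}"
  have fin: "finite ?S" using assms by (simp add: c00_def)
  have "(\<Sum>j<k. l1 (proj (E j) x)) = (\<Sum>j<k. \<Sum>n\<in>?S. \<bar>proj (E j) x n\<bar>)"
    by (intro sum.cong refl l1_supset fin) (auto simp: proj_def)
  also have "\<dots> = (\<Sum>n\<in>?S. \<Sum>j<k. \<bar>proj (E j) x n\<bar>)"
    by (rule sum.swap)
  also have "\<dots> \<le> (\<Sum>n\<in>?S. \<bar>x n\<bar>)"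
  proof (rule sum_mono)
    fix n
    show "(\<Sum>j<k. \<bar>proj (E j) x n\<bar>) \<le> \<bar>x n\<bar>"
    proof (cases "\<exists>i<k. n \<in> E i")
      case True
      then obtain i where i: "i < k" "n \<in> E i" by blast
      have "(\<Sum>j<k. \<bar>proj (E j) x n\<bar>) = (\<Sum>j\<in>{i}. \<bar>proj (E j) x n\<bar>)"
        by (rule sum.mono_neutral_right)
           (use i admissible_disjoint[OF assms(1)] in \<open>auto simp: proj_def\<close>)
      then show ?thesis by (simp add: proj_def)
    qed (auto simp: proj_def)
  qed
  finally show ?thesis by (simp add: l1_def)
qed

lemma abs_le_l1:
  assumes "x \<in> c00"
  shows "\<bar>x n\<bar> \<le> l1 x"
proof (cases "x n = 0")
  case False
  then show ?thesis
    unfolding l1_def using assms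
    by (intro member_le_sum[where f = "\<lambda>n. \<bar>x n\<bar>"]) (auto simp: c00_def)
qed (simp add: l1_nonneg)

lemma admissible_nonempty: "admissible \<noteq> {}"
proof -
  have "(1, \<lambda>_. {1}) \<in> admissible" by (simp add: admissible_def)
  then show ?thesis by blast
qed

lemma tnorm_step_bounds:
  assumes "0 < \<alpha>" "\<alpha> < 1" "x \<in> c00"
  shows "0 \<le> tnorm_step \<alpha> m x \<and> tnorm_step \<alpha> m x \<le> l1 x"
  using assms(3)
proof (induction m arbitrary: x)
  case 0
  have "bdd_above (range (\<lambda>n. \<bar>x n\<bar>))"
    using abs_le_l1[OF 0] by (auto intro!: bdd_aboveI)
  then have "\<bar>x 0\<bar> \<le> (SUP n. \<bar>x n\<bar>)" by (rule cSUP_upper[rotated]) simp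
  moreover have "(SUP n. \<bar>x n\<bar>) \<le> l1 x"
    by (rule cSUP_least) (use abs_le_l1[OF 0] in auto)
  ultimately show ?case by simp
next
  case (Suc m)
  have "(SUP (k, E) \<in> admissible. \<Sum>j<k. tnorm_step \<alpha> m (proj (E j) x)) \<le> l1 x"
    (is "?s \<le> _")
  proof (rule cSUP_least[OF admissible_nonempty], clarify)
    fix k E assume kE: "(k, E) \<in> admissible"
    have "(\<Sum>j<k. tnorm_step \<alpha> m (proj (E j) x)) \<le> (\<Sum>j<k. l1 (proj (E j) x))"
      by (intro sum_mono) (use Suc c00_proj in blast)
    also have "\<dots> \<le> l1 x" by (rule sum_l1_le[OF kE Suc.prems])
    finally show "(\<Sum>j<k. tnorm_step \<alpha> m (proj (E j) x)) \<le> l1 x" .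
  qed
  then have "\<alpha> * ?s \<le> \<alpha> * l1 x" using assms(1) by simp
  also have "\<dots> \<le> l1 x" using assms l1_nonneg[of x] by (simp add: mult_left_le_one_le)
  finally show ?case using Suc by (auto simp: le_max_iff_disj)
qed

lemma tnorm_step_sum_le:
  assumes "0 < \<alpha>" "\<alpha> < 1" "x \<in> c00" "(k, E) \<in> admissible"
  shows "\<alpha> * (\<Sum>j<k. tnorm_step \<alpha> m (proj (E j) x)) \<le> tnorm_step \<alpha> (Suc m) x"
proof -
  have "bdd_above ((\<lambda>(k, E). \<Sum>j<k. tnorm_step \<alpha> m (proj (E j) x)) ` admissible)"
  proof (rule bdd_aboveI[of _ "l1 x"], clarify)
    fix k E assume kE: "(k, E) \<in> admissible"
    have "(\<Sum>j<k. tnorm_step \<alpha> m (proj (E j) x)) \<le> (\<Sum>j<k. l1 (proj (E j) x))"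
      by (intro sum_mono) (use assms tnorm_step_bounds c00_proj in blast)
    also have "\<dots> \<le> l1 x" by (rule sum_l1_le[OF kE assms(3)])
    finally show "(\<Sum>j<k. tnorm_step \<alpha> m (proj (E j) x)) \<le> l1 x" .
  qed
  from cSUP_upper[OF assms(4) this]
  have "(\<Sum>j<k. tnorm_step \<alpha> m (proj (E j) x))
      \<le> (SUP (k, E) \<in> admissible. \<Sum>j<k. tnorm_step \<alpha> m (proj (E j) x))" by simp
  then show ?thesis using assms(1) by (simp add: le_max_iff_disj)
qed

lemma tnorm_step_tendsto:
  assumes "0 < \<alpha>" "\<alpha> < 1" "x \<in> c00"
  shows "(\<lambda>m. tnorm_step \<alpha> m x) \<longlonglongrightarrow> tnorm \<alpha> x" and "tnorm_step \<alpha> m x \<le> tnorm \<alpha> x"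
proof -
  have inc: "incseq (\<lambda>m. tnorm_step \<alpha> m x)" by (rule incseq_SucI) simp
  obtain L where L: "(\<lambda>m. tnorm_step \<alpha> m x) \<longlonglongrightarrow> L" "\<And>m. tnorm_step \<alpha> m x \<le> L"
    using incseq_convergent[OF inc, of "l1 x"] tnorm_step_bounds[OF assms] by blast
  moreover have "L = tnorm \<alpha> x" using L(1) by (simp add: tnorm_def limI)
  ultimately show "(\<lambda>m. tnorm_step \<alpha> m x) \<longlonglongrightarrow> tnorm \<alpha> x" "tnorm_step \<alpha> m x \<le> tnorm \<alpha> x"
    by auto
qed

lemma norming_step:
  assumes "0 < \<alpha>" "\<alpha> < 1" "x \<in> c00" "0 < e"
  shows "\<exists>f. (\<forall>y\<in>c00. \<bar>pairing f y\<bar> \<le> tnorm_step \<alpha> m y) \<and> tnorm_step \<alpha> m x - e \<le> pairing f x"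
  using assms(3,4)
proof (induction m arbitrary: x e)
  case 0
  have bdd: "bdd_above (range (\<lambda>n. \<bar>y n\<bar>))" if "y \<in> c00" for y
    using abs_le_l1[OF that] by (auto intro!: bdd_aboveI)
  have "\<exists>n. (SUP n. \<bar>x n\<bar>) - e < \<bar>x n\<bar>"
    using less_cSUP_iff[OF _ bdd[OF 0(1)], of "(SUP n. \<bar>x n\<bar>) - e"] 0 by auto
  then obtain n where n: "(SUP n. \<bar>x n\<bar>) - e < \<bar>x n\<bar>" by blast
  define f where "f = (\<lambda>k. if k = n then sgn (x n) else 0)"
  have f: "pairing f y = sgn (x n) * y n" if "y \<in> c00" for y
  proof -
    have "pairing f y = (\<Sum>k\<in>insert n {k. y k \<noteq> 0}. f k * y k)"
      by (rule pairing_supset) (use that in \<open>auto simp: c00_def\<close>)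
    also have "\<dots> = (\<Sum>k\<in>{n}. f k * y k)"
      by (rule sum.mono_neutral_right) (use that in \<open>auto simp: c00_def f_def\<close>)
    finally show ?thesis by (simp add: f_def)
  qed
  have "\<bar>pairing f y\<bar> \<le> tnorm_step \<alpha> 0 y" if "y \<in> c00" for y
  proof -
    have "\<bar>pairing f y\<bar> \<le> \<bar>y n\<bar>"
      by (simp add: f[OF that] abs_mult abs_sgn_eq)
    also have "\<dots> \<le> (SUP n. \<bar>y n\<bar>)" by (rule cSUP_upper[OF _ bdd[OF that]]) simp
    finally show ?thesis by simp
  qed
  moreover have "tnorm_step \<alpha> 0 x - e \<le> pairing f x"
    using n by (simp add: f[OF 0(1)] sgn_mult_self_eq linordered_idom_class.abs_sgn mult.commute)
  ultimately show ?case by blast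
next
  case (Suc m)
  let ?g = "\<lambda>(k, E). \<Sum>j<k. tnorm_step \<alpha> m (proj (E j) x)"
  let ?s = "SUP kE \<in> admissible. ?g kE"
  show ?case
  proof (cases "\<alpha> * ?s \<le> tnorm_step \<alpha> m x")
    case True
    obtain f where f: "\<forall>y\<in>c00. \<bar>pairing f y\<bar> \<le> tnorm_step \<alpha> m y" "tnorm_step \<alpha> m x - e \<le> pairing f x"
      using Suc by blast
    have "\<forall>y\<in>c00. \<bar>pairing f y\<bar> \<le> tnorm_step \<alpha> (Suc m) y" using f(1) by fastforce
    moreover have "tnorm_step \<alpha> (Suc m) x - e \<le> pairing f x" using f(2) True by simp
    ultimately show ?thesis by blast
  next
    case False
    have "\<exists>kE\<in>admissible. ?s - e / 2 < ?g kE"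
      using less_cSupE[of "?s - e / 2" "?g ` admissible"] admissible_nonempty Suc.prems
      by (smt (verit, ccfv_threshold) field_sum_of_halves imageE image_is_empty)
    then obtain k E where kE: "(k, E) \<in> admissible"
      and gt: "?s - e / 2 < (\<Sum>j<k. tnorm_step \<alpha> m (proj (E j) x))" by auto
    have k: "1 \<le> k" using kE by (auto simp: admissible_def)
    have "\<exists>f. (\<forall>y\<in>c00. \<bar>pairing f y\<bar> \<le> tnorm_step \<alpha> m y) \<and>
        tnorm_step \<alpha> m (proj (E j) x) - e / (2 * real k) \<le> pairing f (proj (E j) x)" for j
      by (rule Suc.IH) (use Suc.prems k c00_proj in auto)
    then obtain f where f1: "\<And>j y. y \<in> c00 \<Longrightarrow> \<bar>pairing (f j) y\<bar> \<le> tnorm_step \<alpha> m y"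
      and f2: "\<And>j. tnorm_step \<alpha> m (proj (E j) x) - e / (2 * real k) \<le> pairing (f j) (proj (E j) x)"
      by metis
    define h where "h = (\<lambda>n. \<alpha> * (\<Sum>j<k. proj (E j) (f j) n))"
    have h: "pairing h y = \<alpha> * (\<Sum>j<k. pairing (f j) (proj (E j) y))" if y: "y \<in> c00" for y
    proof -
      have "pairing (f j) (proj (E j) y) = (\<Sum>n | y n \<noteq> 0. proj (E j) (f j) n * y n)" for j
      proof -
        have "pairing (f j) (proj (E j) y) = (\<Sum>n | y n \<noteq> 0. f j n * proj (E j) y n)"
          by (rule pairing_supset) (use y in \<open>auto simp: c00_def proj_def\<close>)
        also have "\<dots> = (\<Sum>n | y n \<noteq> 0. proj (E j) (f j) n * y n)"
          by (rule sum.cong) (auto simp: proj_def)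
        finally show ?thesis .
      qed
      then have "(\<Sum>j<k. pairing (f j) (proj (E j) y))
          = (\<Sum>n | y n \<noteq> 0. \<Sum>j<k. proj (E j) (f j) n * y n)"
        by (simp add: sum.swap[of _ _ "{..<k}"])
      then show ?thesis
        by (simp add: pairing_def h_def sum_distrib_left sum_distrib_right mult.assoc)
    qed
    have "\<bar>pairing h y\<bar> \<le> tnorm_step \<alpha> (Suc m) y" if y: "y \<in> c00" for y
    proof -
      have "\<bar>pairing h y\<bar> = \<alpha> * \<bar>\<Sum>j<k. pairing (f j) (proj (E j) y)\<bar>"
        using assms(1) by (simp add: h[OF y] abs_mult)
      also have "\<dots> \<le> \<alpha> * (\<Sum>j<k. tnorm_step \<alpha> m (proj (E j) y))"
        using assms(1) f1 c00_proj[OF y]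
        by (intro mult_left_mono order_trans[OF sum_abs] sum_mono) auto
      also have "\<dots> \<le> tnorm_step \<alpha> (Suc m) y"
        by (rule tnorm_step_sum_le[OF assms(1,2) y kE])
      finally show ?thesis .
    qed
    moreover have "tnorm_step \<alpha> (Suc m) x - e \<le> pairing h x"
    proof -
      have "(\<Sum>j<k. tnorm_step \<alpha> m (proj (E j) x)) - e / 2
          = (\<Sum>j<k. tnorm_step \<alpha> m (proj (E j) x) - e / (2 * real k))"
        using k by (simp add: sum_subtractf)
      also have "\<dots> \<le> (\<Sum>j<k. pairing (f j) (proj (E j) x))"
        by (intro sum_mono f2)
      finally have "?s - e \<le> (\<Sum>j<k. pairing (f j) (proj (E j) x))" using gt by linarith
      then have "\<alpha> * (?s - e) \<le> pairing h x"
        using assms(1) by (simp add: h[OF Suc.prems(1)])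
      moreover have "\<alpha> * e \<le> e" using assms Suc.prems by (simp add: mult_left_le_one_le)
      ultimately have "\<alpha> * ?s - e \<le> pairing h x" by (simp add: right_diff_distrib)
      then show ?thesis using False by simp
    qed
    ultimately show ?thesis by blast
  qed
qed

lemma apply_embed:
  assumes "x \<in> c00"
  shows "apply_bcontfun (embed \<alpha> x) f =
    (if of_discrete f \<in> dual_ball \<alpha> then pairing (of_discrete f) x else 0)"
proof -
  let ?F = "\<lambda>f. if of_discrete f \<in> dual_ball \<alpha> then pairing (of_discrete f) x else 0"
  have "continuous_on UNIV ?F"
    by (simp add: continuous_on_open_vimage open_discrete)
  moreover have "bounded (range ?F)"
    by (rule boundedI[of _ "max 0 (tnorm \<alpha> x)"])
       (use assms in \<open>auto simp: dual_ball_def le_max_iff_disj\<close>)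
  ultimately show ?thesis
    unfolding embed_def by (subst Bcontfun_inverse) (auto simp: bcontfun_def)
qed

lemma embed_add:
  assumes "x \<in> c00" "y \<in> c00"
  shows "embed \<alpha> (\<lambda>n. x n + y n) = embed \<alpha> x + embed \<alpha> y"
  by (rule bcontfun_eqI) (simp add: assms apply_embed c00_add pairing_add)

lemma embed_scale:
  assumes "x \<in> c00"
  shows "embed \<alpha> (\<lambda>n. c * x n) = c *\<^sub>R embed \<alpha> x"
  by (rule bcontfun_eqI) (simp add: assms apply_embed c00_scale pairing_scale)

lemma norm_embed:
  assumes "0 < \<alpha>" "\<alpha> < 1" "x \<in> c00"
  shows "norm (embed \<alpha> x) = tnorm \<alpha> x"
proof (rule antisym)
  have "0 \<le> tnorm \<alpha> x"
    using tnorm_step_bounds[OF assms, of 0] tnorm_step_tendsto(2)[OF assms, of 0] by linarith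
  then show "norm (embed \<alpha> x) \<le> tnorm \<alpha> x"
    by (intro norm_bound) (use assms in \<open>auto simp: apply_embed dual_ball_def\<close>)
  have "tnorm_step \<alpha> m x \<le> norm (embed \<alpha> x)" for m
  proof (rule field_le_epsilon)
    fix e :: real assume "0 < e"
    then obtain f where f: "\<forall>y\<in>c00. \<bar>pairing f y\<bar> \<le> tnorm_step \<alpha> m y"
        "tnorm_step \<alpha> m x - e \<le> pairing f x"
      using norming_step[OF assms] by blast
    have "f \<in> dual_ball \<alpha>"
      using f(1) tnorm_step_tendsto(2)[OF assms(1,2)] order_trans
      unfolding dual_ball_def by blast
    then have "pairing f x = apply_bcontfun (embed \<alpha> x) (discrete f)"
      by (simp add: apply_embed assms discrete_inverse)
    also have "\<dots> \<le> norm (embed \<alpha> x)"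
      using norm_bounded[of "embed \<alpha> x" "discrete f"] by simp
    finally show "tnorm_step \<alpha> m x \<le> norm (embed \<alpha> x) + e" using f(2) by linarith
  qed
  then show "tnorm \<alpha> x \<le> norm (embed \<alpha> x)"
    by (intro LIMSEQ_le_const2[OF tnorm_step_tendsto(1)[OF assms]]) auto
qed

lemma banach_subspace_T_space: "banach_subspace (T_space \<alpha>)"
proof -
  have sub: "subspace (embed \<alpha> ` c00)"
  proof (rule subspaceI)
    have "(\<lambda>_. 0) \<in> c00" by (simp add: c00_def)
    moreover have "embed \<alpha> (\<lambda>_. 0) = 0"
      using embed_scale[of "\<lambda>_. 0" \<alpha> 0] by (simp add: c00_def)
    ultimately show "0 \<in> embed \<alpha> ` c00" by (metis imageI)
  next
    fix u v assume "u \<in> embed \<alpha> ` c00" "v \<in> embed \<alpha> ` c00"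
    then show "u + v \<in> embed \<alpha> ` c00" by (force simp: embed_add[symmetric] c00_add)
  next
    fix c u assume "u \<in> embed \<alpha> ` c00"
    then show "c *\<^sub>R u \<in> embed \<alpha> ` c00" by (force simp: embed_scale[symmetric] c00_scale)
  qed
  have "subspace (closure S)" if S: "subspace S"
    for S :: "((nat \<Rightarrow> real) discrete \<Rightarrow>\<^sub>C real) set"
  proof (rule subspaceI)
    show "0 \<in> closure S" using subspace_0[OF S] closure_subset by blast
  next
    fix u v assume "u \<in> closure S" "v \<in> closure S"
    then obtain a b where "\<And>n. a n \<in> S" "a \<longlonglongrightarrow> u" "\<And>n. b n \<in> S" "b \<longlonglongrightarrow> v"
      unfolding closure_sequential by blast
    then have "\<And>n. a n + b n \<in> S" "(\<lambda>n. a n + b n) \<longlonglongrightarrow> u + v"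
      using subspace_add[OF S] by (auto intro: tendsto_add)
    then show "u + v \<in> closure S"
      unfolding closure_sequential by (intro exI[of _ "\<lambda>n. a n + b n"]) simp
  next
    fix c u assume "u \<in> closure S"
    then obtain a where "\<And>n. a n \<in> S" "a \<longlonglongrightarrow> u"
      unfolding closure_sequential by blast
    then have "\<And>n. c *\<^sub>R a n \<in> S" "(\<lambda>n. c *\<^sub>R a n) \<longlonglongrightarrow> c *\<^sub>R u"
      using subspace_scale[OF S] by (auto intro: tendsto_intros)
    then show "c *\<^sub>R u \<in> closure S"
      unfolding closure_sequential by (intro exI[of _ "\<lambda>n. c *\<^sub>R a n"]) simp
  qed
  from this[OF sub] show ?thesis by (simp add: banach_subspace_def T_space_def)
qed

end

theory Submission
  imports Defs
begin

text \<open>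
  Suppose that the relation of a basic sequence \<open>x\<close> reduces to the relations of both \<open>T\<^sub>\<alpha>\<close> and
  \<open>T\<^sub>\<beta>\<close>, where \<open>\<beta> < \<alpha>\<close>. The two target spaces are indexed by a Boolean throughout, with parameters
  \<open>\<gamma> True = \<alpha>\<close> and \<open>\<gamma> False = \<beta>\<close>.

  A Borel reduction carries no linear structure, and the first half of the proof recovers some.
  A point \<open>d\<close> of Baire space codes the coefficient sequence whose \<open>k\<close>-th term is \<open>2\<close> to the power
  \<open>- d k\<close> (or \<open>0\<close>, if \<open>d k = 0\<close>) divided by \<open>\<parallel>x\<^sub>k\<parallel>\<close>. On a comeager set the two
  reductions are continuous there, and since a finite change of \<open>d\<close> does not change its class, it
  moves the value of a reduction by a vector that is small far out. A fusion argument turns this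
  into \<open>additive_reduction\<close>: there are free positions \<open>n\<^sub>0 < n\<^sub>1 < \<dots>\<close> and consecutive intervals such
  that, when all other digits are frozen and the \<open>k\<close>-th free digit is at most \<open>k\<close>, the value of
  either reduction on the \<open>k\<close>-th interval depends, up to a summable error, on the \<open>k\<close>-th free digit
  alone. So the \<open>k\<close>-th free digit \<open>i\<close> is sent to a block vector \<open>H True k i\<close> of \<open>T\<^sub>\<alpha>\<close> and to a block
  vector \<open>H False k i\<close> of \<open>T\<^sub>\<beta>\<close>, and for every choice of digits the two series of blocks
  converge or diverge together.

  The second half is about such pairs of block vectors. Gluing finite choices of digits one after
  the other shows that smallness in one space forces smallness in the other
  (\<open>uniform_transfer\<close>). Since the blocks of a fixed digit do not tend to \<open>0\<close> while suitable digits
  give arbitrarily short blocks, one finds, arbitrarily far out and whenever \<open>0 < \<mu> \<le> 1\<close>, digits for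
  which the \<open>T\<^sub>\<beta>\<close>-vector has norm at most \<open>\<mu>\<close> and the \<open>T\<^sub>\<alpha>\<close>-vector has norm at least \<open>c\<^sub>0 \<mu>\<close>
  (\<open>base_step\<close>). Now split \<open>\<mu>\<close> into \<open>m\<close> equal parts and put \<open>m\<close> such pieces one after the other,
  beyond \<open>m\<close>. By the definition of the norm, the lower bound in \<open>T\<^sub>\<alpha>\<close> is multiplied by \<open>\<alpha>\<close>, while the
  upper bound in \<open>T\<^sub>\<beta>\<close> is multiplied by a factor as close to \<open>\<beta>\<close> as desired if \<open>m\<close> is large
  (\<open>spread_le_average\<close>). After \<open>n\<close> rounds
  the ratio of the two norms is at least a constant times \<open>(\<alpha> / \<rho>)\<^sup>n\<close> for a fixed \<open>\<rho> < \<alpha>\<close>, which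
  contradicts \<open>uniform_transfer\<close>.
\<close>

section \<open>Estimates for the Tsirelson norms\<close>

lemma c00_zero: "(\<lambda>_. 0) \<in> c00"
  by (simp add: c00_def)

lemma c00_proj_finite: "finite A \<Longrightarrow> proj A x \<in> c00"
  unfolding c00_def proj_def by (auto elim: finite_subset[rotated])

lemma c00_sum:
  assumes "\<And>i. i \<in> I \<Longrightarrow> x i \<in> c00"
  shows "(\<lambda>n. \<Sum>i\<in>I. x i n) \<in> c00"
  using assms by (induction I rule: infinite_finite_induct) (auto simp: c00_zero c00_add)

lemma proj_proj: "proj A (proj B x) = proj (A \<inter> B) x"
  by (auto simp: proj_def)

lemma proj_add: "proj A (\<lambda>n. x n + y n) = (\<lambda>n. proj A x n + proj A y n)"
  by (auto simp: proj_def)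

lemma proj_sum: "proj A (\<lambda>n. \<Sum>i\<in>I. x i n) = (\<lambda>n. \<Sum>i\<in>I. proj A (x i) n)"
  by (auto simp: proj_def)

lemma proj_id: "{n. x n \<noteq> 0} \<subseteq> A \<Longrightarrow> proj A x = x"
  by (fastforce simp: proj_def)

lemma proj_null: "(\<And>n. n \<in> A \<Longrightarrow> x n = 0) \<Longrightarrow> proj A x = (\<lambda>_. 0)"
  by (auto simp: proj_def)

lemma tnorm_zero:
  assumes "\<gamma> \<in> {0<..<1}" shows "tnorm \<gamma> (\<lambda>_. 0) = 0"
proof -
  have "embed \<gamma> (\<lambda>_. 0) = 0"
    using embed_scale[of "\<lambda>_. 0" \<gamma> 0] by (simp add: c00_def)
  then show ?thesis using norm_embed[of \<gamma> "\<lambda>_. 0"] assms c00_zero by simp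
qed

lemma tnorm_nonneg: "\<gamma> \<in> {0<..<1} \<Longrightarrow> x \<in> c00 \<Longrightarrow> 0 \<le> tnorm \<gamma> x"
  using norm_embed[of \<gamma> x] norm_ge_zero[of "embed \<gamma> x"] by simp

lemma tnorm_add:
  assumes "\<gamma> \<in> {0<..<1}" "x \<in> c00" "y \<in> c00"
  shows "tnorm \<gamma> (\<lambda>n. x n + y n) \<le> tnorm \<gamma> x + tnorm \<gamma> y"
  using assms norm_embed[of \<gamma>] c00_add norm_triangle_ineq[of "embed \<gamma> x" "embed \<gamma> y"]
  by (simp add: embed_add[symmetric])

lemma tnorm_minus:
  assumes "\<gamma> \<in> {0<..<1}" "x \<in> c00"
  shows "tnorm \<gamma> (\<lambda>n. - x n) = tnorm \<gamma> x"
proof -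
  have "embed \<gamma> (\<lambda>n. - x n) = - embed \<gamma> x" using embed_scale[OF assms(2), of \<gamma> "-1"] by simp
  then show ?thesis
    using assms norm_embed[of \<gamma> x] norm_embed[of \<gamma> "\<lambda>n. - x n"] c00_scale[of x "-1"] by simp
qed

lemma tnorm_sum:
  assumes "\<gamma> \<in> {0<..<1}" "\<And>i. i \<in> I \<Longrightarrow> x i \<in> c00"
  shows "tnorm \<gamma> (\<lambda>n. \<Sum>i\<in>I. x i n) \<le> (\<Sum>i\<in>I. tnorm \<gamma> (x i))"
  using assms(2)
proof (induction I rule: infinite_finite_induct)
  case (insert i I)
  have "tnorm \<gamma> (\<lambda>n. x i n + (\<Sum>i\<in>I. x i n)) \<le> tnorm \<gamma> (x i) + tnorm \<gamma> (\<lambda>n. \<Sum>i\<in>I. x i n)"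
    using insert by (intro tnorm_add assms(1) c00_sum) simp_all
  then show ?case using insert by fastforce
qed (simp_all add: tnorm_zero[OF assms(1)])

lemma tnorm_le_l1: "\<gamma> \<in> {0<..<1} \<Longrightarrow> x \<in> c00 \<Longrightarrow> tnorm \<gamma> x \<le> l1 x"
  using tnorm_step_tendsto(1)[of \<gamma> x] tnorm_step_bounds[of \<gamma> x]
  by (intro LIMSEQ_le_const2[of _ "tnorm \<gamma> x"]) auto

lemma bdd_above_abs: "x \<in> c00 \<Longrightarrow> bdd_above (range (\<lambda>n. \<bar>x n\<bar>))"
  using abs_le_l1 by (auto intro!: bdd_aboveI)

lemma abs_le_tnorm:
  assumes "\<gamma> \<in> {0<..<1}" "x \<in> c00"
  shows "\<bar>x n\<bar> \<le> tnorm \<gamma> x"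
  using cSUP_upper[OF _ bdd_above_abs[OF assms(2)], of n] tnorm_step_tendsto(2)[of \<gamma> x 0] assms
  by simp

lemma tnorm_step_proj_le:
  assumes "\<gamma> \<in> {0<..<1}" "x \<in> c00"
  shows "tnorm_step \<gamma> m (proj A x) \<le> tnorm_step \<gamma> m x"
  using assms(2)
proof (induction m arbitrary: x)
  case 0
  have "(SUP n. \<bar>proj A x n\<bar>) \<le> (SUP n. \<bar>x n\<bar>)"
  proof (rule cSUP_least)
    fix n
    have "\<bar>proj A x n\<bar> \<le> \<bar>x n\<bar>" by (simp add: proj_def)
    also have "\<dots> \<le> (SUP n. \<bar>x n\<bar>)" by (rule cSUP_upper[OF _ bdd_above_abs[OF 0]]) simp
    finally show "\<bar>proj A x n\<bar> \<le> (SUP n. \<bar>x n\<bar>)" .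
  qed simp
  then show ?case by simp
next
  case (Suc m)
  have "\<gamma> * (\<Sum>j<k. tnorm_step \<gamma> m (proj (E j) (proj A x))) \<le> tnorm_step \<gamma> (Suc m) x"
    if kE: "(k, E) \<in> admissible" for k E
  proof -
    have "(\<Sum>j<k. tnorm_step \<gamma> m (proj (E j) (proj A x))) \<le> (\<Sum>j<k. tnorm_step \<gamma> m (proj (E j) x))"
    proof (rule sum_mono)
      fix j
      show "tnorm_step \<gamma> m (proj (E j) (proj A x)) \<le> tnorm_step \<gamma> m (proj (E j) x)"
        using Suc.IH[OF c00_proj[OF Suc.prems], of "E j"] by (simp add: proj_proj Int_commute)
    qed
    then have "\<gamma> * (\<Sum>j<k. tnorm_step \<gamma> m (proj (E j) (proj A x)))
        \<le> \<gamma> * (\<Sum>j<k. tnorm_step \<gamma> m (proj (E j) x))"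
      using assms(1) by simp
    also have "\<dots> \<le> tnorm_step \<gamma> (Suc m) x"
      by (rule tnorm_step_sum_le) (use assms Suc.prems kE in auto)
    finally show ?thesis .
  qed
  then have "(\<Sum>j<k. tnorm_step \<gamma> m (proj (E j) (proj A x))) \<le> tnorm_step \<gamma> (Suc m) x / \<gamma>"
    if "(k, E) \<in> admissible" for k E
    using that assms(1) by (simp add: field_simps)
  then have "(SUP (k, E) \<in> admissible. \<Sum>j<k. tnorm_step \<gamma> m (proj (E j) (proj A x)))
      \<le> tnorm_step \<gamma> (Suc m) x / \<gamma>"
    by (intro cSUP_least[OF admissible_nonempty]) (auto simp del: tnorm_step.simps)
  then have "\<gamma> * (SUP (k, E) \<in> admissible. \<Sum>j<k. tnorm_step \<gamma> m (proj (E j) (proj A x)))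
      \<le> tnorm_step \<gamma> (Suc m) x"
    using assms(1) by (simp add: field_simps del: tnorm_step.simps)
  moreover have "tnorm_step \<gamma> m (proj A x) \<le> tnorm_step \<gamma> (Suc m) x"
    using Suc by (auto simp: le_max_iff_disj)
  ultimately show ?case by (subst tnorm_step.simps(2)) (rule max.boundedI)
qed

lemma tnorm_proj_le:
  assumes "\<gamma> \<in> {0<..<1}" "x \<in> c00"
  shows "tnorm \<gamma> (proj A x) \<le> tnorm \<gamma> x"
  using tnorm_step_tendsto(1)[of \<gamma> "proj A x"] tnorm_step_tendsto(1)[of \<gamma> x]
    tnorm_step_proj_le[OF assms] assms c00_proj[OF assms(2)]
  by (intro LIMSEQ_le[of _ "tnorm \<gamma> (proj A x)" _ "tnorm \<gamma> x"]) auto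

lemma tnorm_admissible_le:
  assumes "\<gamma> \<in> {0<..<1}" "x \<in> c00" "(k, E) \<in> admissible"
  shows "\<gamma> * (\<Sum>j<k. tnorm \<gamma> (proj (E j) x)) \<le> tnorm \<gamma> x"
proof (rule LIMSEQ_le_const2)
  show "(\<lambda>m. \<gamma> * (\<Sum>j<k. tnorm_step \<gamma> m (proj (E j) x)))
      \<longlonglongrightarrow> \<gamma> * (\<Sum>j<k. tnorm \<gamma> (proj (E j) x))"
    using assms tnorm_step_tendsto(1) c00_proj by (intro tendsto_intros) auto
  have "\<gamma> * (\<Sum>j<k. tnorm_step \<gamma> m (proj (E j) x)) \<le> tnorm \<gamma> x" for m
    using tnorm_step_sum_le[of \<gamma> x k E m] tnorm_step_tendsto(2)[of \<gamma> x "Suc m"] assms by fastforce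
  then show "\<exists>N. \<forall>m\<ge>N. \<gamma> * (\<Sum>j<k. tnorm_step \<gamma> m (proj (E j) x)) \<le> tnorm \<gamma> x" by blast
qed

text \<open>
  Together with \<open>abs_le_tnorm\<close> and \<open>tnorm_admissible_le\<close> this is the implicit description of the norm:
  the limit norm \<open>\<parallel>x\<parallel>\<close> is the larger of the supremum norm and of \<open>\<gamma>\<close> times the supremum of the sums
  \<open>\<Sum>\<parallel>E\<^sub>j x\<parallel>\<close> over the admissible families.
\<close>

lemma tnorm_leI:
  assumes "\<gamma> \<in> {0<..<1}" "x \<in> c00" "\<And>n. \<bar>x n\<bar> \<le> B"
    "\<And>k E. (k, E) \<in> admissible \<Longrightarrow> \<gamma> * (\<Sum>j<k. tnorm \<gamma> (proj (E j) x)) \<le> B"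
  shows "tnorm \<gamma> x \<le> B"
proof -
  have "tnorm_step \<gamma> m x \<le> B" for m
  proof (induction m)
    case 0
    then show ?case using assms(3) by (auto intro: cSUP_least)
  next
    case (Suc m)
    have "(SUP (k, E) \<in> admissible. \<Sum>j<k. tnorm_step \<gamma> m (proj (E j) x)) \<le> B / \<gamma>"
    proof (rule cSUP_least[OF admissible_nonempty], clarify)
      fix k E assume kE: "(k, E) \<in> admissible"
      have "(\<Sum>j<k. tnorm_step \<gamma> m (proj (E j) x)) \<le> (\<Sum>j<k. tnorm \<gamma> (proj (E j) x))"
        by (intro sum_mono tnorm_step_tendsto(2)) (use assms c00_proj in auto)
      also have "\<dots> \<le> B / \<gamma>" using assms(4)[OF kE] assms(1) by (simp add: field_simps)
      finally show "(\<Sum>j<k. tnorm_step \<gamma> m (proj (E j) x)) \<le> B / \<gamma>" .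
    qed
    then have "\<gamma> * (SUP (k, E) \<in> admissible. \<Sum>j<k. tnorm_step \<gamma> m (proj (E j) x)) \<le> B"
      using assms(1) by (simp add: field_simps)
    then show ?case using Suc by simp
  qed
  then show ?thesis
    using tnorm_step_tendsto(1)[of \<gamma> x] assms by (intro LIMSEQ_le_const2) auto
qed

text \<open>
  Unlike an admissible family, a successive one may be indexed by any set of natural numbers and may
  contain empty sets, so that it can be intersected with a set or restricted at will.
\<close>

definition successive :: "nat set \<Rightarrow> (nat \<Rightarrow> nat set) \<Rightarrow> bool" where
  "successive J E \<longleftrightarrow> (\<forall>i\<in>J. \<forall>j\<in>J. i < j \<longrightarrow> (\<forall>a\<in>E i. \<forall>b\<in>E j. a < b))"

text \<open>
  Empty members contribute nothing; the other ones, enumerated in increasing order and cut down to the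
  support of \<open>x\<close>, form an admissible family.
\<close>

lemma tnorm_successive_le:
  assumes g: "\<gamma> \<in> {0<..<1}" and x: "x \<in> c00" and J: "finite J" "successive J E"
    and card: "\<And>j a. j \<in> J \<Longrightarrow> a \<in> E j \<Longrightarrow> card J \<le> a"
  shows "\<gamma> * (\<Sum>j\<in>J. tnorm \<gamma> (proj (E j) x)) \<le> tnorm \<gamma> x"
proof -
  define S where "S = {n. x n \<noteq> 0}"
  define I where "I = {j\<in>J. E j \<inter> S \<noteq> {}}"
  have fin: "finite I" "finite S" using J x by (auto simp: I_def S_def c00_def)
  have sum: "(\<Sum>j\<in>J. tnorm \<gamma> (proj (E j) x)) = (\<Sum>j\<in>I. tnorm \<gamma> (proj (E j \<inter> S) x))"
  proof (rule sum.mono_neutral_cong_right[OF J(1)])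
    show "\<forall>i\<in>J - I. tnorm \<gamma> (proj (E i) x) = 0"
    proof
      fix i assume "i \<in> J - I"
      then have "proj (E i) x = (\<lambda>_. 0)" by (intro proj_null) (auto simp: I_def S_def)
      then show "tnorm \<gamma> (proj (E i) x) = 0" using tnorm_zero[OF g] by simp
    qed
    show "tnorm \<gamma> (proj (E i) x) = tnorm \<gamma> (proj (E i \<inter> S) x)" for i
    proof -
      have "proj (E i) x = proj (E i \<inter> S) x" by (auto simp: proj_def S_def)
      then show ?thesis by simp
    qed
  qed (auto simp: I_def)
  show ?thesis
  proof (cases "I = {}")
    case True
    then show ?thesis using sum tnorm_nonneg[OF g x] by simp
  next
    case False
    obtain h where h: "bij_betw h {..<card I} I" "strict_mono_on {..<card I} h"
      using ex_bij_betw_strict_mono_card[OF fin(1)] by blast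
    have hI: "h i \<in> I" if "i < card I" for i using h(1) that by (auto simp: bij_betw_def)
    have "card I \<le> card J" using J(1) by (intro card_mono) (auto simp: I_def)
    have "(card I, \<lambda>i. E (h i) \<inter> S) \<in> admissible"
      unfolding admissible_def
    proof (clarsimp, intro conjI allI impI)
      show "Suc 0 \<le> card I" using False fin by (simp add: Suc_le_eq card_gt_0_iff)
      show "finite (E (h j) \<inter> S)" for j using fin by simp
      show "E (h j) \<inter> S \<noteq> {}" if "j < card I" for j using hI[OF that] by (simp add: I_def)
      have 0: "0 < card I" using False fin by (simp add: card_gt_0_iff)
      then have "E (h 0) \<inter> S \<noteq> {}" using hI[OF 0] by (simp add: I_def)
      then show "card I \<le> Min (E (h 0) \<inter> S)"
        using card[of "h 0"] hI[OF 0] \<open>card I \<le> card J\<close> fin by (fastforce simp: I_def)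
      fix j assume j: "Suc j < card I"
      have "h j < h (Suc j)" using h(2) j by (auto simp: strict_mono_on_def)
      then have "\<forall>a\<in>E (h j). \<forall>b\<in>E (h (Suc j)). a < b"
        using J(2) hI[OF j] hI[OF Suc_lessD[OF j]] by (auto simp: successive_def I_def)
      then show "Max (E (h j) \<inter> S) < Min (E (h (Suc j)) \<inter> S)"
        using hI[OF j] hI[OF Suc_lessD[OF j]] fin by (auto simp: I_def)
    qed
    from tnorm_admissible_le[OF g x this]
    have "\<gamma> * (\<Sum>j<card I. tnorm \<gamma> (proj (E (h j) \<inter> S) x)) \<le> tnorm \<gamma> x" .
    also have "(\<Sum>j<card I. tnorm \<gamma> (proj (E (h j) \<inter> S) x)) = (\<Sum>j\<in>I. tnorm \<gamma> (proj (E j \<inter> S) x))"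
      by (rule sum.reindex_bij_betw[OF h(1)])
    finally show ?thesis using sum by simp
  qed
qed

section \<open>Convergence of coefficient sequences\<close>

definition tail_cauchy :: "real \<Rightarrow> (nat \<Rightarrow> real) \<Rightarrow> bool" where
  "tail_cauchy \<gamma> a \<longleftrightarrow> (\<forall>\<epsilon>>0. \<exists>l. \<forall>m. tnorm \<gamma> (proj {l..<m} a) \<le> \<epsilon>)"

lemma embed_sum_unit:
  assumes "finite A"
  shows "(\<Sum>n\<in>A. a n *\<^sub>R t_vec \<gamma> n) = embed \<gamma> (proj A a)"
  using assms
proof (induction A)
  case empty
  have "embed \<gamma> (\<lambda>_. 0) = 0" using embed_scale[OF c00_zero, of \<gamma> 0] by simp
  then show ?case by (simp add: proj_def)
next
  case (insert n A)
  have u: "(\<lambda>k. if k = n then 1 else 0) \<in> c00" by (simp add: c00_def)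
  have "(\<Sum>n\<in>insert n A. a n *\<^sub>R t_vec \<gamma> n) = embed \<gamma> (\<lambda>k. a n * (if k = n then 1 else 0)) + embed \<gamma> (proj A a)"
    using insert by (simp add: embed_scale[OF u] t_vec_def)
  also have "\<dots> = embed \<gamma> (\<lambda>k. a n * (if k = n then 1 else 0) + proj A a k)"
    by (rule embed_add[symmetric]) (intro c00_scale u c00_proj_finite insert)+
  also have "(\<lambda>k. a n * (if k = n then 1 else 0) + proj A a k) = proj (insert n A) a"
    using insert by (auto simp: proj_def)
  finally show ?case .
qed

text \<open>
  By \<open>embed_sum_unit\<close> the norm of a partial sum of \<open>\<Sum>a\<^sub>n t\<^sub>n\<close> over an interval is the norm of the
  restriction of \<open>a\<close>. Hence \<open>tail_cauchy\<close> is the Cauchy criterion, in which, because restriction does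
  not increase norms, the left end of the interval may be kept fixed.
\<close>

lemma coef_T_iff:
  assumes "\<gamma> \<in> {0<..<1}"
  shows "a \<in> coef (T_space \<gamma>) (t_vec \<gamma>) \<longleftrightarrow> tail_cauchy \<gamma> a"
proof -
  have "norm (\<Sum>n\<in>{l..<m}. a n *\<^sub>R t_vec \<gamma> n) = tnorm \<gamma> (proj {l..<m} a)" for l m
    using norm_embed[of \<gamma> "proj {l..<m} a"] assms c00_proj_finite[of "{l..<m}" a]
    by (simp add: embed_sum_unit)
  then have sc: "summable (\<lambda>n. a n *\<^sub>R t_vec \<gamma> n) \<longleftrightarrow>
      (\<forall>e>0. \<exists>N. \<forall>m\<ge>N. \<forall>n. tnorm \<gamma> (proj {m..<n} a) < e)"
    by (simp add: summable_Cauchy)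
  have "\<dots> \<longleftrightarrow> tail_cauchy \<gamma> a"
    unfolding tail_cauchy_def
  proof (intro iffI allI impI)
    fix e :: real assume *: "\<forall>e>0. \<exists>N. \<forall>m\<ge>N. \<forall>n. tnorm \<gamma> (proj {m..<n} a) < e" "e > 0"
    then show "\<exists>l. \<forall>m. tnorm \<gamma> (proj {l..<m} a) \<le> e" by (meson less_imp_le order_refl)
  next
    fix e :: real assume *: "\<forall>e>0. \<exists>l. \<forall>m. tnorm \<gamma> (proj {l..<m} a) \<le> e" "e > 0"
    then obtain l where l: "\<And>m. tnorm \<gamma> (proj {l..<m} a) \<le> e / 2"
      by (meson half_gt_zero)
    have "tnorm \<gamma> (proj {m..<n} a) < e" if "m \<ge> l" for m n
    proof -
      have "proj {m..<n} a = proj {m..<n} (proj {l..<n} a)" using that by (auto simp: proj_def)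
      then have "tnorm \<gamma> (proj {m..<n} a) \<le> tnorm \<gamma> (proj {l..<n} a)"
        using tnorm_proj_le[OF assms, of "proj {l..<n} a" "{m..<n}"] c00_proj_finite by simp
      then show ?thesis using l[of n] *(2) by simp
    qed
    then show "\<exists>N. \<forall>m\<ge>N. \<forall>n. tnorm \<gamma> (proj {m..<n} a) < e" by blast
  qed
  moreover have "a \<in> coef (T_space \<gamma>) (t_vec \<gamma>) \<longleftrightarrow> summable (\<lambda>n. a n *\<^sub>R t_vec \<gamma> n)"
  proof
    assume "summable (\<lambda>n. a n *\<^sub>R t_vec \<gamma> n)"
    then obtain z where z: "(\<lambda>n. a n *\<^sub>R t_vec \<gamma> n) sums z" by (auto simp: summable_def)
    have "(\<Sum>n<m. a n *\<^sub>R t_vec \<gamma> n) \<in> T_space \<gamma>" for m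
      unfolding T_space_def embed_sum_unit[OF finite_lessThan]
      by (rule subsetD[OF closure_subset], rule imageI, rule c00_proj_finite) simp
    then have "z \<in> T_space \<gamma>"
      using z closed_sequentially[of "T_space \<gamma>" "\<lambda>m. \<Sum>n<m. a n *\<^sub>R t_vec \<gamma> n" z]
      unfolding sums_def by (simp add: T_space_def)
    then show "a \<in> coef (T_space \<gamma>) (t_vec \<gamma>)" using z by (auto simp: coef_def)
  qed (auto simp: coef_def summable_def)
  ultimately show ?thesis using sc by simp
qed

lemma tail_cauchyD:
  assumes "tail_cauchy \<gamma> a" "\<epsilon> > 0"
  obtains l where "\<And>m. tnorm \<gamma> (proj {l..<m} a) \<le> \<epsilon>"
  using assms unfolding tail_cauchy_def by blast

lemma tnorm_interval_mono:
  assumes "\<gamma> \<in> {0<..<1}" "l \<le> l'" "m' \<le> m"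
  shows "tnorm \<gamma> (proj {l'..<m'} a) \<le> tnorm \<gamma> (proj {l..<m} a)"
proof -
  have "proj {l'..<m'} a = proj {l'..<m'} (proj {l..<m} a)" using assms by (auto simp: proj_def)
  then show ?thesis using tnorm_proj_le[OF assms(1)] c00_proj_finite by simp
qed

lemma tail_cauchy_add:
  assumes g: "\<gamma> \<in> {0<..<1}" and a: "tail_cauchy \<gamma> a" and b: "tail_cauchy \<gamma> b"
  shows "tail_cauchy \<gamma> (\<lambda>n. a n + b n)"
  unfolding tail_cauchy_def
proof (intro allI impI)
  fix e :: real assume "e > 0"
  then obtain l l' where l: "\<And>m. tnorm \<gamma> (proj {l..<m} a) \<le> e / 2"
    and l': "\<And>m. tnorm \<gamma> (proj {l'..<m} b) \<le> e / 2"
    using tail_cauchyD[OF a, of "e / 2"] tail_cauchyD[OF b, of "e / 2"] by (metis half_gt_zero)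
  have "tnorm \<gamma> (proj {max l l'..<m} (\<lambda>n. a n + b n)) \<le> e" for m
  proof -
    have "tnorm \<gamma> (proj {max l l'..<m} (\<lambda>n. a n + b n))
        \<le> tnorm \<gamma> (proj {max l l'..<m} a) + tnorm \<gamma> (proj {max l l'..<m} b)"
      unfolding proj_add by (intro tnorm_add g c00_proj_finite) auto
    also have "\<dots> \<le> tnorm \<gamma> (proj {l..<m} a) + tnorm \<gamma> (proj {l'..<m} b)"
      by (intro add_mono tnorm_interval_mono g) auto
    finally show ?thesis using l[of m] l'[of m] by simp
  qed
  then show "\<exists>l. \<forall>m. tnorm \<gamma> (proj {l..<m} (\<lambda>n. a n + b n)) \<le> e" by blast
qed

lemma tail_cauchy_minus:
  assumes g: "\<gamma> \<in> {0<..<1}" and a: "tail_cauchy \<gamma> a"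
  shows "tail_cauchy \<gamma> (\<lambda>n. - a n)"
proof -
  have "proj A (\<lambda>n. - a n) = (\<lambda>n. - proj A a n)" for A by (auto simp: proj_def)
  then have "tnorm \<gamma> (proj {l..<m} (\<lambda>n. - a n)) = tnorm \<gamma> (proj {l..<m} a)" for l m
    by (simp add: tnorm_minus[OF g c00_proj_finite])
  then show ?thesis using a by (simp add: tail_cauchy_def)
qed

text \<open>
  The tail of a sequence beyond \<open>b K\<close> is at most the sum of its blocks from the \<open>K\<close>-th on.
\<close>

lemma tail_cauchy_blocks:
  assumes g: "\<gamma> \<in> {0<..<1}" and b: "strict_mono b" and \<epsilon>: "summable \<epsilon>"
    and blocks: "\<And>k. tnorm \<gamma> (proj {b k..<b (Suc k)} a) \<le> \<epsilon> k"
  shows "tail_cauchy \<gamma> a"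
  unfolding tail_cauchy_def
proof (intro allI impI)
  fix e :: real assume "e > 0"
  then obtain K where K: "\<And>m n. m \<ge> K \<Longrightarrow> norm (sum \<epsilon> {m..<n}) < e"
    using \<epsilon> by (meson summable_Cauchy)
  have \<epsilon>0: "0 \<le> \<epsilon> k" for k
    using tnorm_nonneg[OF g c00_proj_finite] order_trans[OF _ blocks[of k]] by blast
  have *: "tnorm \<gamma> (proj {b K..<b (K + i)} a) \<le> sum \<epsilon> {K..<K + i}" for i
  proof (induction i)
    case 0
    then show ?case using tnorm_zero[OF g] by (simp add: proj_def)
  next
    case (Suc i)
    have le: "b K \<le> b (K + i)" "b (K + i) \<le> b (Suc (K + i))"
      using b by (simp_all add: strict_mono_less_eq)
    have "proj {b K..<b (K + Suc i)} a = (\<lambda>n. proj {b K..<b (K + i)} a n + proj {b (K + i)..<b (Suc (K + i))} a n)"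
      using le by (auto simp: proj_def fun_eq_iff)
    then have "tnorm \<gamma> (proj {b K..<b (K + Suc i)} a)
        \<le> tnorm \<gamma> (proj {b K..<b (K + i)} a) + tnorm \<gamma> (proj {b (K + i)..<b (Suc (K + i))} a)"
      using tnorm_add[OF g c00_proj_finite c00_proj_finite] by simp
    then show ?case using Suc blocks[of "K + i"] by simp
  qed
  have "tnorm \<gamma> (proj {b K..<m} a) \<le> e" for m
  proof -
    have "m \<le> b (K + m)" using strict_mono_imp_increasing[OF b, of "K + m"] by simp
    then have "tnorm \<gamma> (proj {b K..<m} a) \<le> tnorm \<gamma> (proj {b K..<b (K + m)} a)"
      by (intro tnorm_interval_mono g) auto
    also have "\<dots> \<le> e" using *[of m] K[of K "K + m"] by simp
    finally show ?thesis .
  qed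
  then show "\<exists>l. \<forall>m. tnorm \<gamma> (proj {l..<m} a) \<le> e" by blast
qed

lemma not_tail_cauchyI:
  assumes g: "\<gamma> \<in> {0<..<1}" and "\<epsilon> > 0" "\<And>k. \<exists>l m. k \<le> l \<and> \<epsilon> < tnorm \<gamma> (proj {l..<m} a)"
  shows "\<not> tail_cauchy \<gamma> a"
proof
  assume "tail_cauchy \<gamma> a"
  then obtain k where k: "\<And>m. tnorm \<gamma> (proj {k..<m} a) \<le> \<epsilon>" using assms(2) tail_cauchyD by blast
  obtain l m where lm: "k \<le> l" "\<epsilon> < tnorm \<gamma> (proj {l..<m} a)" using assms(3) by blast
  have "tnorm \<gamma> (proj {l..<m} a) \<le> tnorm \<gamma> (proj {k..<m} a)"
    by (rule tnorm_interval_mono[OF g]) (use lm in auto)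
  then show False using k[of m] lm by simp
qed

text \<open>
  The restricted norm is Lipschitz for the \<open>\<ell>\<^sub>1\<close> norm of finitely many coordinates. The lemma makes
  the sets occurring in the fusion argument Borel.
\<close>

lemma tnorm_proj_continuous:
  assumes g: "\<gamma> \<in> {0<..<1}" and A: "finite A"
  shows "continuous_on UNIV (\<lambda>x::nat \<Rightarrow> real. tnorm \<gamma> (proj A x))"
proof -
  have lip: "tnorm \<gamma> (proj A x) - tnorm \<gamma> (proj A y) \<le> (\<Sum>j\<in>A. \<bar>x j - y j\<bar>)" for x y
  proof -
    have p: "proj A x \<in> c00" "proj A y \<in> c00" "proj A (\<lambda>j. x j - y j) \<in> c00"
      using c00_proj_finite[OF A] by blast+
    have "proj A x = (\<lambda>j. proj A (\<lambda>j. x j - y j) j + proj A y j)" by (auto simp: proj_def)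
    then have "tnorm \<gamma> (proj A x) \<le> tnorm \<gamma> (proj A (\<lambda>j. x j - y j)) + tnorm \<gamma> (proj A y)"
      using tnorm_add[OF g p(3) p(2)] by simp
    also have "tnorm \<gamma> (proj A (\<lambda>j. x j - y j)) \<le> l1 (proj A (\<lambda>j. x j - y j))"
      by (rule tnorm_le_l1[OF g p(3)])
    also have "l1 (proj A (\<lambda>j. x j - y j)) = (\<Sum>j\<in>A. \<bar>x j - y j\<bar>)"
      by (subst l1_supset[OF A]) (auto simp: proj_def)
    finally show ?thesis by simp
  qed
  have "((\<lambda>x. tnorm \<gamma> (proj A x)) \<longlongrightarrow> tnorm \<gamma> (proj A y)) (at y)" for y :: "nat \<Rightarrow> real"
  proof (rule LIM_zero_cancel, rule Lim_null_comparison)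
    show "\<forall>\<^sub>F x in at y. norm (tnorm \<gamma> (proj A x) - tnorm \<gamma> (proj A y)) \<le> (\<Sum>j\<in>A. \<bar>x j - y j\<bar>)"
      using lip lip[of y] by (intro always_eventually) (simp add: abs_le_iff abs_minus_commute)
    have "continuous_on UNIV (\<lambda>x :: nat \<Rightarrow> real. \<Sum>j\<in>A. \<bar>x j - y j\<bar>)"
      by (intro continuous_intros continuous_on_product_coordinates)
    then have "((\<lambda>x. \<Sum>j\<in>A. \<bar>x j - y j\<bar>) \<longlongrightarrow> (\<Sum>j\<in>A. \<bar>y j - y j\<bar>)) (at y)"
      by (simp only: continuous_on_def) blast
    then show "((\<lambda>x. \<Sum>j\<in>A. \<bar>x j - y j\<bar>) \<longlongrightarrow> 0) (at y)" by simp
  qed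
  then show ?thesis by (auto simp: continuous_on_def)
qed

section \<open>Baire category in Baire space\<close>

definition cyl :: "nat list \<Rightarrow> (nat \<Rightarrow> nat) set" where
  "cyl w = {x. \<forall>i<length w. x i = w ! i}"

lemma cyl_append: "cyl (w @ u) \<subseteq> cyl w"
  by (auto simp: cyl_def nth_append split: if_splits)

lemma cyl_append_subset: "cyl w \<subseteq> U \<Longrightarrow> cyl (w @ u) \<subseteq> U"
  using cyl_append by blast

lemma open_cyl: "open (cyl w)"
proof -
  have "cyl w = (\<Inter>i<length w. (\<lambda>x. x i) -` {w ! i})" by (auto simp: cyl_def)
  moreover have "open ((\<lambda>x :: nat \<Rightarrow> nat. x i) -` {w ! i})" for i
    by (intro open_vimage continuous_on_product_coordinates) (rule Topological_Spaces.open_discrete)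
  ultimately show ?thesis by (auto intro: open_INT)
qed

lemma open_contains_cyl:
  assumes "open U" "x \<in> U" "x \<in> cyl w"
  obtains u where "cyl (w @ u) \<subseteq> U"
proof -
  have "\<exists>X. x \<in> Pi\<^sub>E UNIV X \<and> (\<forall>i. openin euclidean (X i)) \<and>
      finite {i. X i \<noteq> topspace (euclidean :: nat topology)} \<and> Pi\<^sub>E UNIV X \<subseteq> U"
    by (rule product_topology_open_contains_basis[OF assms(1)[unfolded open_fun_def] assms(2)])
  then obtain X where X': "x \<in> Pi\<^sub>E UNIV X \<and> (\<forall>i. openin euclidean (X i)) \<and>
      finite {i. X i \<noteq> topspace (euclidean :: nat topology)} \<and> Pi\<^sub>E UNIV X \<subseteq> U" ..
  then have X: "x \<in> Pi\<^sub>E UNIV X" "finite {i. X i \<noteq> UNIV}" "Pi\<^sub>E UNIV X \<subseteq> U"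
    unfolding topspace_euclidean by - (elim conjE, assumption)+
  obtain n where n: "\<And>i. X i \<noteq> UNIV \<Longrightarrow> i < n"
    using X(2) unfolding finite_nat_set_iff_bounded by blast
  define u where "u = map x [length w..<length w + n]"
  have xi: "x i = (w @ u) ! i" if "i < length w + n" for i
    using that assms(3) by (auto simp: u_def nth_append cyl_def)
  have "y \<in> Pi\<^sub>E UNIV X" if y: "y \<in> cyl (w @ u)" for y
  proof -
    have "y i \<in> X i" for i
    proof (cases "X i = UNIV")
      case False
      then have "i < length w + n" using n[of i] by simp
      then have "y i = x i" using y xi by (simp add: cyl_def u_def)
      then show ?thesis using X(1) by (auto simp: PiE_iff)
    qed simp
    then show ?thesis by auto
  qed
  then have "cyl (w @ u) \<subseteq> U" using X(3) by blast
  then show ?thesis by (rule that)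
qed

definition dense_open :: "(nat \<Rightarrow> nat) set \<Rightarrow> bool" where
  "dense_open W \<longleftrightarrow> open W \<and> (\<forall>w. \<exists>u. cyl (w @ u) \<subseteq> W)"

lemma nested_words_limit:
  fixes w :: "nat \<Rightarrow> nat list"
  assumes ext: "\<And>k. \<exists>u. w (Suc k) = w k @ u" and len: "\<And>k. k \<le> length (w k)"
  shows "(\<lambda>i. w (Suc i) ! i) \<in> cyl (w k)"
proof -
  have mono: "\<exists>u. w (k + m) = w k @ u" for k m
  proof (induction m)
    case (Suc m)
    then show ?case using ext[of "k + m"] by auto
  qed simp
  have "w (Suc i) ! i = w k ! i" if "i < length (w k)" for i
  proof (cases "Suc i \<le> k")
    case True
    then obtain u where "w k = w (Suc i) @ u" using mono[of "Suc i" "k - Suc i"] by auto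
    then show ?thesis using len[of "Suc i"] by (simp add: nth_append)
  next
    case False
    then obtain u where "w (Suc i) = w k @ u" using mono[of k "Suc i - k"] by auto
    then show ?thesis using that by (simp add: nth_append)
  qed
  then show ?thesis by (auto simp: cyl_def)
qed

lemma baire_category:
  assumes "\<And>j::nat. dense_open (W j)"
  obtains x where "x \<in> cyl w" "\<And>j. x \<in> W j"
proof -
  have "\<exists>ws. \<forall>k. (k \<le> length (ws k) \<and> (\<exists>u. ws k = w @ u)) \<and>
      ((\<exists>u. ws (Suc k) = ws k @ u) \<and> cyl (ws (Suc k)) \<subseteq> W k)"
  proof (rule dependent_nat_choice)
    show "\<exists>x. 0 \<le> length x \<and> (\<exists>u. x = w @ u)" by auto
    fix x k assume x: "k \<le> length x \<and> (\<exists>u. x = w @ u)"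
    obtain u where "cyl ((x @ [0]) @ u) \<subseteq> W k" using assms unfolding dense_open_def by blast
    then show "\<exists>y. (Suc k \<le> length y \<and> (\<exists>u. y = w @ u)) \<and> (\<exists>u. y = x @ u) \<and> cyl y \<subseteq> W k"
      using x by (intro exI[of _ "x @ [0] @ u"]) auto
  qed
  then obtain ws where ws: "\<And>k. k \<le> length (ws k)" "\<And>k. \<exists>u. ws k = w @ u"
    "\<And>k. \<exists>u. ws (Suc k) = ws k @ u" "\<And>k. cyl (ws (Suc k)) \<subseteq> W k" by blast
  have *: "(\<lambda>i. ws (Suc i) ! i) \<in> cyl (ws k)" for k
    by (rule nested_words_limit) (use ws in auto)
  show ?thesis
  proof (rule that)
    obtain u where "ws 0 = w @ u" using ws(2) by blast
    then show "(\<lambda>i. ws (Suc i) ! i) \<in> cyl w" using *[of 0] cyl_append[of w u] by auto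
    show "(\<lambda>i. ws (Suc i) ! i) \<in> W j" for j using *[of "Suc j"] ws(4) by blast
  qed
qed

text \<open>
  The property of Baire: equality with an open set on the intersection of countably many dense open
  sets.
\<close>

definition almost_open :: "(nat \<Rightarrow> nat) set \<Rightarrow> bool" where
  "almost_open B \<longleftrightarrow> (\<exists>U W. open U \<and> (\<forall>j::nat. dense_open (W j)) \<and>
     (\<forall>x. (\<forall>j. x \<in> W j) \<longrightarrow> (x \<in> B \<longleftrightarrow> x \<in> U)))"

lemma dense_open_UNIV: "dense_open UNIV"
  by (simp add: dense_open_def)

lemma almost_open_open: "open U \<Longrightarrow> almost_open U"
  unfolding almost_open_def using dense_open_UNIV
  by (intro exI[of _ U] exI[of _ "\<lambda>_. UNIV"]) simp

text \<open>
  If \<open>B\<close> agrees generically with the open set \<open>U\<close>, its complement agrees with the interior of the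
  complement of \<open>U\<close>: what is left over is the boundary of \<open>U\<close>, which is nowhere dense.
\<close>

lemma almost_open_Compl:
  assumes "almost_open B"
  shows "almost_open (- B)"
proof -
  obtain U W where U: "open U" and W: "\<And>j::nat. dense_open (W j)"
    and UW: "\<And>x. (\<forall>j. x \<in> W j) \<Longrightarrow> x \<in> B \<longleftrightarrow> x \<in> U"
    using assms unfolding almost_open_def by blast
  define V where "V = U \<union> interior (- U)"
  have "\<exists>u. cyl (w @ u) \<subseteq> V" for w
  proof (cases "cyl w \<inter> U = {}")
    case True
    then have "cyl w \<subseteq> interior (- U)" by (intro interior_maximal open_cyl) blast
    then show ?thesis by (intro exI[of _ "[]"]) (auto simp: V_def)
  next
    case False
    then obtain x where "x \<in> cyl w" "x \<in> U" by blast
    then obtain u where "cyl (w @ u) \<subseteq> U" using open_contains_cyl[OF U] by metis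
    then show ?thesis unfolding V_def by blast
  qed
  then have V: "dense_open V" using U by (auto simp: dense_open_def V_def)
  show ?thesis
    unfolding almost_open_def
  proof (intro exI conjI allI impI)
    show "open (interior (- U))" by simp
    show "dense_open (case_nat V W j)" for j using V W by (auto split: nat.split)
    fix x assume x: "\<forall>j. x \<in> (case j of 0 \<Rightarrow> V | Suc j \<Rightarrow> W j)"
    have "x \<in> V" using spec[OF x, of 0] by simp
    moreover have "x \<in> W j" for j using spec[OF x, of "Suc j"] by simp
    ultimately show "x \<in> - B \<longleftrightarrow> x \<in> interior (- U)"
      using UW interior_subset[of "- U"] by (auto simp: V_def)
  qed
qed

lemma almost_open_Union:
  assumes "\<And>i::nat. almost_open (B i)"
  shows "almost_open (\<Union>i. B i)"
proof -
  obtain U W where U: "\<And>i. open (U i)" and W: "\<And>i j::nat. dense_open (W i j)"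
    and UW: "\<And>i x. (\<forall>j. x \<in> W i j) \<Longrightarrow> x \<in> B i \<longleftrightarrow> x \<in> U i"
    using assms unfolding almost_open_def by metis
  show ?thesis
    unfolding almost_open_def
  proof (intro exI conjI allI impI)
    show "open (\<Union>i. U i)" using U by blast
    show "dense_open (case prod_decode j of (i, j) \<Rightarrow> W i j)" for j using W by (simp split: prod.split)
    fix x assume x: "\<forall>j. x \<in> (case prod_decode j of (i, j) \<Rightarrow> W i j)"
    have "x \<in> W i j" for i j using spec[OF x, of "prod_encode (i, j)"] by simp
    then have "x \<in> B i \<longleftrightarrow> x \<in> U i" for i by (intro UW allI)
    then show "x \<in> (\<Union>i. B i) \<longleftrightarrow> x \<in> (\<Union>i. U i)" by simp
  qed
qed

lemma almost_open_borel:
  assumes "B \<in> sets borel"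
  shows "almost_open B"
proof -
  have "B \<in> sigma_sets UNIV {S. open S}" using assms by (simp add: borel_def)
  then show ?thesis
  proof induction
    case (Compl B)
    then show ?case using almost_open_Compl[of B] by (simp add: Compl_eq_Diff_UNIV)
  qed (auto intro: almost_open_open almost_open_Union)
qed

text \<open>
  For a countable cover by Borel sets, some piece is comeager in an open subset of any given open set.
  In terms of words: every word has an extension that decides, for all generic points passing through
  it, one piece in which they lie. The statement treats countably many covers at once, so that
  one notion of genericity, given by the sets \<open>W j\<close>, serves them all.
\<close>

lemma generic_cover:
  fixes B :: "'c::countable \<Rightarrow> 'l::countable \<Rightarrow> (nat \<Rightarrow> nat) set"
  assumes borel: "\<And>c l. B c l \<in> sets borel" and cover: "\<And>c. (\<Union>l. B c l) = UNIV"
  obtains U W where "\<And>j::nat. dense_open (W j)" "\<And>c w. \<exists>u l. cyl (w @ u) \<subseteq> U c l"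
    "\<And>c l x. (\<And>j. x \<in> W j) \<Longrightarrow> x \<in> U c l \<Longrightarrow> x \<in> B c l"
proof -
  obtain U V where U: "\<And>c l. open (U c l)" and V: "\<And>c l (j::nat). dense_open (V c l j)"
    and UV: "\<And>c l x. (\<forall>j. x \<in> V c l j) \<Longrightarrow> x \<in> B c l \<longleftrightarrow> x \<in> U c l"
    using almost_open_borel[OF borel] unfolding almost_open_def by metis
  define W where "W = (\<lambda>n. case from_nat n of (c, l, j) \<Rightarrow> V c l j)"
  have W: "dense_open (W n)" for n using V by (simp add: W_def split: prod.split)
  have WV: "x \<in> V c l j" if "\<And>n. x \<in> W n" for x c l j
    using that[of "to_nat (c, l, j)"] by (simp add: W_def)
  show ?thesis
  proof (rule that)
    show "\<exists>u l. cyl (w @ u) \<subseteq> U c l" for c w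
    proof -
      obtain x where x: "x \<in> cyl w" "\<And>n. x \<in> W n" using baire_category[of W w] W by blast
      obtain l where "x \<in> B c l" using cover[of c] by blast
      then have "x \<in> U c l" using UV WV[OF x(2)] by blast
      then obtain u where "cyl (w @ u) \<subseteq> U c l" using open_contains_cyl[OF U _ x(1)] by blast
      then show ?thesis by blast
    qed
    show "x \<in> B c l" if "\<And>j. x \<in> W j" "x \<in> U c l" for c l x
      using UV WV[OF that(1)] that(2) by blast
  qed (rule W)
qed

section \<open>Fusion\<close>

text \<open>
  A single extension \<open>u\<close> is found that works for finitely many words and requirements: they are met one
  after the other, and appending further letters does not spoil what has been achieved.
\<close>

lemma simultaneous_extension:
  fixes Q :: "'j \<Rightarrow> nat list \<Rightarrow> bool"
  assumes "finite P" and her: "\<And>j w u. Q j w \<Longrightarrow> Q j (w @ u)" and dense: "\<And>j w. \<exists>u. Q j (w @ u)"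
  shows "\<exists>u. \<forall>(r, j)\<in>P. Q j (r @ u)"
  using assms(1)
proof (induction P)
  case (insert p P)
  then obtain u where u: "\<forall>(r, j)\<in>P. Q j (r @ u)" by blast
  obtain r j where p: "p = (r, j)" by (cases p)
  obtain v where v: "Q j ((r @ u) @ v)" using dense by blast
  show ?case
    using u v p her by (intro exI[of _ "u @ v"]) (auto simp: append_assoc[symmetric] simp del: append_assoc)
qed simp

text \<open>
  The words along which the fusion proceeds: the \<open>k\<close>-th free digit \<open>d k\<close> is followed by the fixed word
  \<open>s k\<close>, which is the same for all choices of the digits.
\<close>

primrec branch :: "(nat \<Rightarrow> nat list) \<Rightarrow> (nat \<Rightarrow> nat) \<Rightarrow> nat \<Rightarrow> nat list" where
  "branch s d 0 = []"
| "branch s d (Suc k) = branch s d k @ d k # s k"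

text \<open>
  The free digit number \<open>k\<close> takes only the values \<open>0, \<dots>, k\<close>, so that at every stage there are finitely
  many branches and one word \<open>s k\<close> can be chosen that makes all of them meet the requirements.
  The requirements of type \<open>A\<close>, one for every branch, produce numbers \<open>l\<close>, and \<open>b (Suc k)\<close> is chosen
  above all of these; only then is it known which coordinates \<open>j\<close> the requirements of type \<open>C\<close> concern
  and how precise they have to be.
\<close>

lemma fusion:
  fixes W :: "nat \<Rightarrow> (nat \<Rightarrow> nat) set" and A :: "nat list \<Rightarrow> nat \<Rightarrow> nat \<Rightarrow> (nat \<Rightarrow> nat) set"
    and C :: "bool \<Rightarrow> nat \<Rightarrow> nat \<Rightarrow> nat \<Rightarrow> (nat \<Rightarrow> nat) set"
  assumes W: "\<And>j. dense_open (W j)"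
    and A: "\<And>z k w. \<exists>u l. cyl (w @ u) \<subseteq> A z k l"
    and C: "\<And>c j p w. \<exists>u q. cyl (w @ u) \<subseteq> C c j p q"
  obtains s b where "strict_mono b" "b 0 = 0"
    "\<And>d k j. (\<And>i. d i \<le> i) \<Longrightarrow> j \<le> k \<Longrightarrow> cyl (branch s d (Suc k)) \<subseteq> W j"
    "\<And>d k. (\<And>i. d i \<le> i) \<Longrightarrow>
       \<exists>l\<le>b (Suc k). cyl (branch s d (Suc k)) \<subseteq> A (branch s (\<lambda>_. 0) k @ [0]) k l"
    "\<And>d k c j. (\<And>i. d i \<le> i) \<Longrightarrow> j < b (Suc k) \<Longrightarrow>
       \<exists>q. cyl (branch s d (Suc k)) \<subseteq> C c j (b (Suc k) * 2 ^ k) q"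
proof -
  define good where "good = (\<lambda>k z l w.
     (\<forall>j\<le>k. cyl w \<subseteq> W j) \<and> (\<exists>l0\<le>l. cyl w \<subseteq> A (z @ [0]) k l0) \<and>
     (\<forall>j<l. \<forall>c. \<exists>q. cyl w \<subseteq> C c j (l * 2 ^ k) q))"
  have step: "\<exists>s l'. l < l' \<and> (\<forall>r\<in>F. \<forall>i\<le>k. good k z l' (r @ i # s))" if F: "finite F" for k l z F
  proof -
    define R where "R = (\<lambda>(r, i). r @ [i]) ` (F \<times> {..k})"
    have R: "finite R" using F by (simp add: R_def)
    define Q where "Q = (\<lambda>j w. case j of None \<Rightarrow> \<exists>l0. cyl w \<subseteq> A (z @ [0]) k l0 | Some j \<Rightarrow> cyl w \<subseteq> W j)"
    have "\<exists>u. \<forall>(r, j)\<in>R \<times> insert None (Some ` {..k}). Q j (r @ u)"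
    proof (rule simultaneous_extension)
      show "Q j (w @ u)" if "Q j w" for j w u
        using that cyl_append_subset by (fastforce simp: Q_def split: option.splits)
      show "\<exists>u. Q j (w @ u)" for j w
        using W A by (cases j) (auto simp: Q_def dense_open_def)
    qed (use R in simp)
    then obtain u where u: "\<And>r j. r \<in> R \<Longrightarrow> j \<in> insert None (Some ` {..k}) \<Longrightarrow> Q j (r @ u)" by blast
    have "\<forall>r\<in>R. \<exists>l0. cyl (r @ u) \<subseteq> A (z @ [0]) k l0" using u[of _ None] by (simp add: Q_def)
    then obtain f where f: "\<And>r. r \<in> R \<Longrightarrow> cyl (r @ u) \<subseteq> A (z @ [0]) k (f r)" by metis
    define l' where "l' = Suc l + sum f R"
    have fl: "f r \<le> l'" if "r \<in> R" for r using member_le_sum[OF that, of f] R by (simp add: l'_def)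
    have "\<exists>v. \<forall>(r, jc)\<in>(\<lambda>r. r @ u) ` R \<times> {..<l'} \<times> UNIV.
        \<exists>q. cyl (r @ v) \<subseteq> C (snd jc) (fst jc) (l' * 2 ^ k) q"
    proof (rule simultaneous_extension)
      show "\<exists>q. cyl (w @ v) \<subseteq> C (snd jc) (fst jc) (l' * 2 ^ k) q"
        if "\<exists>q. cyl w \<subseteq> C (snd jc) (fst jc) (l' * 2 ^ k) q" for jc w v
        using that cyl_append_subset by blast
    qed (use R C in simp_all)
    then obtain v where v: "\<forall>(r, jc)\<in>(\<lambda>r. r @ u) ` R \<times> {..<l'} \<times> UNIV.
        \<exists>q. cyl (r @ v) \<subseteq> C (snd jc) (fst jc) (l' * 2 ^ k) q" ..
    have v: "\<exists>q. cyl ((r @ u) @ v) \<subseteq> C c j (l' * 2 ^ k) q" if "r \<in> R" "j < l'" for r j c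
      using bspec[OF v, of "(r @ u, j, c)"] that by simp
    have "good k z l' (r @ i # u @ v)" if ri: "r \<in> F" "i \<le> k" for r i
    proof -
      have rR: "r @ [i] \<in> R" using ri by (auto simp: R_def)
      have eq: "r @ i # u @ v = ((r @ [i]) @ u) @ v" by simp
      show ?thesis
        unfolding good_def eq
      proof (intro conjI allI impI)
        show "cyl (((r @ [i]) @ u) @ v) \<subseteq> W j" if "j \<le> k" for j
          by (rule cyl_append_subset) (use u[OF rR, of "Some j"] that in \<open>simp add: Q_def\<close>)
        show "\<exists>l0\<le>l'. cyl (((r @ [i]) @ u) @ v) \<subseteq> A (z @ [0]) k l0"
          using f[OF rR] fl[OF rR] cyl_append_subset by blast
        show "\<exists>q. cyl (((r @ [i]) @ u) @ v) \<subseteq> C c j (l' * 2 ^ k) q" if "j < l'" for j c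
          by (rule v[OF rR that])
      qed
    qed
    then show ?thesis by (intro exI[of _ "u @ v"] exI[of _ l']) (auto simp: l'_def)
  qed
  (* A stage consists of the branch z with all free digits 0, the set F of all branches, the current
     boundary l, and the fixed word that was appended last. *)
  define inv where "inv = (\<lambda>(k::nat) (z :: nat list, F :: nat list set, l :: nat, s :: nat list).
     finite F \<and> (k = 0 \<longrightarrow> z = [] \<and> F = {[]} \<and> l = 0))"
  define succ where "succ = (\<lambda>(k::nat) (z :: nat list, F :: nat list set, l :: nat, s :: nat list) (z', F', l', s').
     z' = z @ 0 # s' \<and> F' = (\<lambda>(r, i). r @ i # s') ` (F \<times> {..k}) \<and> l < l' \<and> (\<forall>w\<in>F'. good k z l' w))"
  have "\<exists>st. \<forall>k. inv k (st k) \<and> succ k (st k) (st (Suc k))"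
  proof (rule dependent_nat_choice)
    show "\<exists>st. inv 0 st" by (intro exI[of _ "([], {[]}, 0, [])"]) (simp add: inv_def)
    fix st and k
    assume st: "inv k st"
    obtain z F l s where zF: "st = (z, F, l, s)" by (cases st)
    obtain s' l' where s': "l < l'" "\<forall>r\<in>F. \<forall>i\<le>k. good k z l' (r @ i # s')"
      using step[of F l k z] st zF by (auto simp: inv_def)
    show "\<exists>st'. inv (Suc k) st' \<and> succ k st st'"
      using s' st zF
      by (intro exI[of _ "(z @ 0 # s', (\<lambda>(r, i). r @ i # s') ` (F \<times> {..k}), l', s')"])
         (auto simp: inv_def succ_def)
  qed
  then obtain st where st': "\<forall>k. inv k (st k) \<and> succ k (st k) (st (Suc k))" ..
  have st: "inv k (st k)" "succ k (st k) (st (Suc k))" for k using spec[OF st', of k] by simp_all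
  define z where "z = (\<lambda>k. fst (st k))"
  define F where "F = (\<lambda>k. fst (snd (st k)))"
  define b where "b = (\<lambda>k. fst (snd (snd (st k))))"
  define s where "s = (\<lambda>k. snd (snd (snd (st (Suc k)))))"
  have init: "z 0 = []" "F 0 = {[]}" "b 0 = 0"
    using st(1)[of 0] by (auto simp: inv_def z_def F_def b_def case_prod_beta)
  have Suc: "z (Suc k) = z k @ 0 # s k" "F (Suc k) = (\<lambda>(r, i). r @ i # s k) ` (F k \<times> {..k})"
    "b k < b (Suc k)" "\<And>w. w \<in> F (Suc k) \<Longrightarrow> good k (z k) (b (Suc k)) w" for k
    using st(2)[of k] by (auto simp: succ_def z_def F_def b_def s_def case_prod_beta)
  have zb: "z k = branch s (\<lambda>_. 0) k" for k by (induction k) (simp_all add: init Suc)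
  have Fb: "branch s d k \<in> F k" if "\<And>i. d i \<le> i" for d k
  proof (induction k)
    case (Suc k)
    then show ?case using that[of k] by (force simp: \<open>F (Suc k) = _\<close>)
  qed (simp add: init)
  have good: "good k (branch s (\<lambda>_. 0) k) (b (Suc k)) (branch s d (Suc k))" if "\<And>i. d i \<le> i" for d k
    using Suc(4)[OF Fb[OF that]] by (simp add: zb)
  show ?thesis
    by (rule that[of b s]) (use good Suc(3) init(3) in \<open>auto simp: good_def strict_mono_Suc_iff simp del: branch.simps\<close>)
qed

definition overwrite :: "nat list \<Rightarrow> (nat \<Rightarrow> nat) \<Rightarrow> nat \<Rightarrow> nat" where
  "overwrite r x = (\<lambda>i. if i < length r then r ! i else x i)"

lemma overwrite_measurable: "overwrite r \<in> borel_measurable borel"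
proof (rule borel_measurable_continuous_onI, rule continuous_on_coordinatewise_then_product)
  fix i
  show "continuous_on UNIV (\<lambda>x. overwrite r x i)"
    by (cases "i < length r") (simp_all add: overwrite_def continuous_on_product_coordinates)
qed

lemma coordinate_measurable:
  fixes f :: "'a::topological_space \<Rightarrow> nat \<Rightarrow> real"
  assumes "f \<in> borel_measurable borel"
  shows "(\<lambda>x. f x j) \<in> borel_measurable borel"
  by (rule measurable_compose[OF assms])
     (intro borel_measurable_continuous_onI continuous_on_product_coordinates)

lemma length_branch: "length (branch s d k) = length (branch s d' k)"
  by (induction k) auto

lemma branch_cong: "(\<And>i. i < k \<Longrightarrow> d i = d' i) \<Longrightarrow> branch s d k = branch s d' k"
  by (induction k) auto

definition branch_point :: "(nat \<Rightarrow> nat list) \<Rightarrow> (nat \<Rightarrow> nat) \<Rightarrow> nat \<Rightarrow> nat" where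
  "branch_point s d i = branch s d (Suc i) ! i"

lemma branch_point_in_cyl: "branch_point s d \<in> cyl (branch s d k)"
proof -
  have "k \<le> length (branch s d k)" for k by (induction k) auto
  then have "(\<lambda>i. branch s d (Suc i) ! i) \<in> cyl (branch s d k)"
    by (intro nested_words_limit) auto
  then show ?thesis by (simp add: branch_point_def[abs_def])
qed

lemma branch_point_nth: "i < length (branch s d k) \<Longrightarrow> branch_point s d i = branch s d k ! i"
  using branch_point_in_cyl[of s d k] by (auto simp: cyl_def)

definition free_pos :: "(nat \<Rightarrow> nat list) \<Rightarrow> nat \<Rightarrow> nat" where
  "free_pos s k = length (branch s (\<lambda>_. 0) k)"

lemma strict_mono_free_pos: "strict_mono (free_pos s)"
  by (simp add: strict_mono_Suc_iff free_pos_def)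

lemma branch_point_free_pos: "branch_point s d (free_pos s k) = d k"
  using branch_point_nth[of "free_pos s k" s d "Suc k"] length_branch[of s d k "\<lambda>_. 0"]
  by (simp add: free_pos_def nth_append)

text \<open>
  Branches for different digits have equal lengths, so a position that is not free always lies in the
  same place of the same fixed word.
\<close>

lemma branch_point_fixed_pos:
  assumes "i \<notin> range (free_pos s)"
  shows "branch_point s d i = branch_point s d' i"
proof -
  have *: "i < length (branch s d k) \<Longrightarrow> branch s d k ! i = branch s d' k ! i" for k
  proof (induction k)
    case (Suc k)
    have eq: "length (branch s d k) = free_pos s k" "length (branch s d' k) = free_pos s k"
      unfolding free_pos_def by (rule length_branch)+
    have "i \<noteq> free_pos s k" using assms by auto
    then show ?case using Suc eq by (auto simp: nth_append nth_Cons')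
  qed simp
  have "Suc i \<le> length (branch s d (Suc i))" for i d by (induction i) auto
  then have "i < length (branch s d (Suc i))" by (simp add: Suc_le_eq)
  then show ?thesis using * by (simp add: branch_point_def del: branch.simps)
qed

text \<open>
  Replacing an initial segment by that of the branch with zero digits has the effect of resetting the
  free digits up to number \<open>k\<close>. This is how the requirement about finite changes applies to branches.
\<close>

lemma overwrite_branch_point:
  "overwrite (branch s (\<lambda>_. 0) k @ [0]) (branch_point s d) = branch_point s (\<lambda>i. if i < Suc k then 0 else d i)"
    (is "?l = branch_point s ?d")
proof
  fix i
  show "?l i = branch_point s ?d i"
  proof (cases "i < Suc (free_pos s k)")
    case True
    have eq: "branch s ?d (Suc k) = (branch s (\<lambda>_. 0) k @ [0]) @ s k"
      using branch_cong[of k ?d "\<lambda>_. 0" s] by simp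
    have "branch_point s ?d i = ((branch s (\<lambda>_. 0) k @ [0]) @ s k) ! i"
      unfolding eq[symmetric] by (rule branch_point_nth) (use True in \<open>simp add: eq free_pos_def del: branch.simps\<close>)
    then show ?thesis using True by (simp add: overwrite_def free_pos_def nth_append)
  next
    case False
    then have l: "?l i = branch_point s d i" by (simp add: overwrite_def free_pos_def)
    show ?thesis
    proof (cases "i \<in> range (free_pos s)")
      case True
      then obtain j where j: "i = free_pos s j" by blast
      have "j > k" using False j strict_mono_less_eq[OF strict_mono_free_pos, of s j k] by (simp add: not_less_eq_eq)
      then show ?thesis using l by (simp add: j branch_point_free_pos)
    qed (use l branch_point_fixed_pos in metis)
  qed
qed

lemma dense_open_Int:
  assumes "dense_open V" "dense_open W"
  shows "dense_open (V \<inter> W)"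
  unfolding dense_open_def
proof (intro conjI allI)
  fix w
  obtain u where u: "cyl (w @ u) \<subseteq> V" using assms unfolding dense_open_def by blast
  obtain v where v: "cyl ((w @ u) @ v) \<subseteq> W" using assms unfolding dense_open_def by blast
  show "\<exists>u. cyl (w @ u) \<subseteq> V \<inter> W"
    using cyl_append_subset[OF u, of v] v by (intro exI[of _ "u @ v"]) simp
qed (use assms in \<open>auto simp: dense_open_def\<close>)

text \<open>
  Two kinds of requirements are fed into the fusion. For an initial segment \<open>r\<close>, the points at which
  overwriting by \<open>r\<close> changes \<open>\<theta>\<close> by little beyond \<open>l\<close> cover the space as \<open>l\<close> varies, because a finite
  change leads to an equivalent point; deciding \<open>l\<close> bounds the influence of the digits before \<open>k\<close> on the
  \<open>k\<close>-th interval. And deciding, up to a small error, the coordinates below \<open>b (Suc k)\<close> bounds the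
  influence of the digits after \<open>k\<close>. The value on the \<open>k\<close>-th interval therefore hardly changes when all
  digits except the \<open>k\<close>-th are reset to \<open>0\<close>.
\<close>

lemma additive_reduction:
  fixes \<theta> :: "bool \<Rightarrow> (nat \<Rightarrow> nat) \<Rightarrow> nat \<Rightarrow> real" and \<gamma> :: "bool \<Rightarrow> real"
  assumes g: "\<And>c. \<gamma> c \<in> {0<..<1}" and meas: "\<And>c. \<theta> c \<in> borel_measurable borel"
    and fin: "\<And>c x y. finite {i. x i \<noteq> y i} \<Longrightarrow> tail_cauchy (\<gamma> c) (\<lambda>j. \<theta> c x j - \<theta> c y j)"
  shows "\<exists>n b X. strict_mono n \<and> strict_mono b \<and> (\<forall>d k. X d (n k) = d k) \<and>
    (\<forall>d d' i. i \<notin> range n \<longrightarrow> X d i = X d' i) \<and>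
    (\<forall>c d k. (\<forall>i. d i \<le> i) \<longrightarrow> tnorm (\<gamma> c) (proj {b k..<b (Suc k)}
       (\<lambda>j. \<theta> c (X d) j - \<theta> c (X (\<lambda>i. if i = k then d k else 0)) j)) \<le> 4 * (1/2) ^ k)"
proof -
  define diff where "diff = (\<lambda>c r m l x. tnorm (\<gamma> c) (proj {l..<m} (\<lambda>j. \<theta> c x j - \<theta> c (overwrite r x) j)))"
  define A where "A = (\<lambda>(r, e :: nat) l. {x. \<forall>c m. diff c r m l x \<le> (1/2) ^ e})"
  define C where "C = (\<lambda>(c, j, p :: nat) q. {x. \<bar>\<theta> c x j - real_of_int (from_nat q) / (real p + 1)\<bar> \<le> 1 / (real p + 1)})"
  have "diff c r m l \<in> borel_measurable borel" for c r m l
  proof -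
    have "(\<lambda>x j. \<theta> c x j - \<theta> c (overwrite r x) j) \<in> borel_measurable borel"
    proof (rule measurable_coordinatewise_then_product)
      fix j
      have "(\<lambda>x. \<theta> c (overwrite r x) j) \<in> borel_measurable borel"
        by (rule coordinate_measurable, rule measurable_compose[OF overwrite_measurable meas])
      then show "(\<lambda>x. \<theta> c x j - \<theta> c (overwrite r x) j) \<in> borel_measurable borel"
        using coordinate_measurable[OF meas] by (intro borel_measurable_diff)
    qed
    from measurable_compose[OF this borel_measurable_continuous_onI[OF tnorm_proj_continuous[OF g[of c], of "{l..<m}"]]]
    show ?thesis by (simp add: diff_def[abs_def])
  qed
  then have "diff c r m l -` {..e} \<in> sets borel" for c r m l e
    by (rule measurable_sets_borel) simp
  then have "(\<Inter>c. \<Inter>m. diff c r m l -` {..e}) \<in> sets borel" for r l e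
    by (intro sets.countable_INT'') auto
  moreover have "A a l = (\<Inter>c. \<Inter>m. diff c (fst a) m l -` {..(1/2) ^ snd a})" for a l
    by (auto simp: A_def split: prod.splits)
  ultimately have A_borel: "A a l \<in> sets borel" for a l by simp
  have C_borel: "C a q \<in> sets borel" for a q
  proof -
    obtain c j p where a: "a = (c, j, p)" by (cases a)
    have "(\<lambda>x. \<bar>\<theta> c x j - real_of_int (from_nat q) / (real p + 1)\<bar>) \<in> borel_measurable borel"
      using coordinate_measurable[OF meas] by (intro borel_measurable_abs borel_measurable_diff) auto
    then have "(\<lambda>x. \<bar>\<theta> c x j - real_of_int (from_nat q) / (real p + 1)\<bar>) -` {..1 / (real p + 1)} \<in> sets borel"
      by (rule measurable_sets_borel) simp
    then show ?thesis by (simp add: a C_def vimage_def)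
  qed
  have A_cover: "(\<Union>l. A a l) = UNIV" for a
  proof -
    obtain r e where a: "a = (r, e)" by (cases a)
    have "\<exists>l. x \<in> A a l" for x
    proof -
      have "finite {i. x i \<noteq> overwrite r x i}"
        by (rule finite_subset[of _ "{..<length r}"]) (auto simp: overwrite_def split: if_splits)
      then have "\<exists>l. \<forall>m. diff c r m l x \<le> (1/2) ^ e" for c
        using fin[of x "overwrite r x" c] by (simp add: tail_cauchy_def diff_def)
      then obtain l where l: "\<And>c m. diff c r m (l c) x \<le> (1/2) ^ e" by metis
      have "diff c r m (max (l True) (l False)) x \<le> diff c r m (l c) x" for c m
        unfolding diff_def by (rule tnorm_interval_mono[OF g]) (cases c, auto)
      then have "diff c r m (max (l True) (l False)) x \<le> (1/2) ^ e" for c m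
        using l[of c m] order_trans by blast
      then have "x \<in> A a (max (l True) (l False))" by (simp add: A_def a)
      then show ?thesis ..
    qed
    then show ?thesis by blast
  qed
  have C_cover: "(\<Union>q. C a q) = UNIV" for a
  proof -
    obtain c j p where a: "a = (c, j, p)" by (cases a)
    have "x \<in> C a (to_nat \<lfloor>\<theta> c x j * (real p + 1)\<rfloor>)" for x
    proof -
      define t where "t = \<theta> c x j * (real p + 1)"
      have "\<theta> c x j - real_of_int \<lfloor>t\<rfloor> / (real p + 1) = (t - real_of_int \<lfloor>t\<rfloor>) / (real p + 1)"
        by (simp add: t_def field_simps)
      moreover have "0 \<le> t - real_of_int \<lfloor>t\<rfloor>" "t - real_of_int \<lfloor>t\<rfloor> \<le> 1" by linarith+
      ultimately show ?thesis by (simp add: C_def a t_def[symmetric] divide_right_mono)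
    qed
    then show ?thesis by blast
  qed
  (* Both covers are decided generically, and the fusion makes every branch point generic. *)
  obtain UA WA where WA: "\<And>j::nat. dense_open (WA j)" and UA: "\<And>a w. \<exists>u l. cyl (w @ u) \<subseteq> UA a l"
    and UA_A: "\<And>a l x. (\<And>j. x \<in> WA j) \<Longrightarrow> x \<in> UA a l \<Longrightarrow> x \<in> A a l"
    using generic_cover[of A, OF A_borel A_cover] by metis
  obtain UC WC where WC: "\<And>j::nat. dense_open (WC j)" and UC: "\<And>a w. \<exists>u l. cyl (w @ u) \<subseteq> UC a l"
    and UC_C: "\<And>a l x. (\<And>j. x \<in> WC j) \<Longrightarrow> x \<in> UC a l \<Longrightarrow> x \<in> C a l"
    using generic_cover[of C, OF C_borel C_cover] by metis
  obtain s b where b: "strict_mono b" "b 0 = 0"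
    and s_W: "\<And>d k j. (\<And>i. d i \<le> i) \<Longrightarrow> j \<le> k \<Longrightarrow> cyl (branch s d (Suc k)) \<subseteq> WA j \<inter> WC j"
    and s_A: "\<And>d k. (\<And>i. d i \<le> i) \<Longrightarrow>
       \<exists>l\<le>b (Suc k). cyl (branch s d (Suc k)) \<subseteq> UA (branch s (\<lambda>_. 0) k @ [0], k) l"
    and s_C: "\<And>d k c j. (\<And>i. d i \<le> i) \<Longrightarrow> j < b (Suc k) \<Longrightarrow>
       \<exists>q. cyl (branch s d (Suc k)) \<subseteq> UC (c, j, b (Suc k) * 2 ^ k) q"
    using fusion[of "\<lambda>j. WA j \<inter> WC j" "\<lambda>r e. UA (r, e)" "\<lambda>c j p. UC (c, j, p)"]
      dense_open_Int[OF WA WC] UA UC by metis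
  have generic: "branch_point s d \<in> WA j" "branch_point s d \<in> WC j" if "\<And>i. d i \<le> i" for d j
    using s_W[OF that, of j j] branch_point_in_cyl[of s d "Suc j"] by blast+
  have error: "tnorm (\<gamma> c) (proj {b k..<b (Suc k)}
       (\<lambda>j. \<theta> c (branch_point s d) j - \<theta> c (branch_point s (\<lambda>i. if i = k then d k else 0)) j)) \<le> 4 * (1/2) ^ k"
    if d: "\<And>i. d i \<le> i" for c d k
  proof -
    define d1 where "d1 = (\<lambda>i. if i < k then 0 else d i)"
    define d2 where "d2 = (\<lambda>i. if i = k then d k else 0)"
    let ?B = "{b k..<b (Suc k)}"
    define x where "x = branch_point s d"
    define x1 where "x1 = branch_point s d1"
    define x2 where "x2 = branch_point s d2"
    have d1: "d1 i \<le> i" and d2: "d2 i \<le> i" for i using d[of i] d[of k] by (simp_all add: d1_def d2_def)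
    (* Reset the digits before k first and those after k next. *)
    have past: "tnorm (\<gamma> c) (proj ?B (\<lambda>j. \<theta> c x j - \<theta> c x1 j)) \<le> 2 * (1/2) ^ k"
    proof (cases k)
      case 0
      then have "x = x1" by (simp add: x_def x1_def d1_def)
      then show ?thesis using tnorm_zero[OF g[of c]] by (simp add: proj_def)
    next
      case (Suc k')
      obtain l where l: "l \<le> b k" "cyl (branch s d k) \<subseteq> UA (branch s (\<lambda>_. 0) k' @ [0], k') l"
        using s_A[OF d, of k'] Suc by metis
      have "x \<in> UA (branch s (\<lambda>_. 0) k' @ [0], k') l"
        using l(2) branch_point_in_cyl[of s d k] unfolding x_def by blast
      then have "x \<in> A (branch s (\<lambda>_. 0) k' @ [0], k') l"
        by (intro UA_A) (simp_all add: x_def generic[OF d])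
      then have "tnorm (\<gamma> c) (proj {l..<b (Suc k)} (\<lambda>j. \<theta> c x j - \<theta> c x1 j)) \<le> (1/2) ^ k'"
        by (simp add: A_def diff_def x_def x1_def overwrite_branch_point d1_def Suc)
      moreover have "tnorm (\<gamma> c) (proj ?B (\<lambda>j. \<theta> c x j - \<theta> c x1 j))
          \<le> tnorm (\<gamma> c) (proj {l..<b (Suc k)} (\<lambda>j. \<theta> c x j - \<theta> c x1 j))"
        by (rule tnorm_interval_mono[OF g]) (use l in auto)
      ultimately show ?thesis using Suc by simp
    qed
    have future: "\<bar>\<theta> c x1 j - \<theta> c x2 j\<bar> \<le> 2 / (real (b (Suc k)) * 2 ^ k + 1)" if j: "j < b (Suc k)" for j
    proof -
      have "branch s d2 (Suc k) = branch s d1 (Suc k)"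
        by (rule branch_cong) (auto simp: d1_def d2_def less_Suc_eq)
      then have "x1 \<in> cyl (branch s d1 (Suc k))" "x2 \<in> cyl (branch s d1 (Suc k))"
        unfolding x1_def x2_def using branch_point_in_cyl by metis+
      moreover obtain q where "cyl (branch s d1 (Suc k)) \<subseteq> UC (c, j, b (Suc k) * 2 ^ k) q"
        using s_C[OF d1 j, of c] by blast
      ultimately have "x1 \<in> C (c, j, b (Suc k) * 2 ^ k) q" "x2 \<in> C (c, j, b (Suc k) * 2 ^ k) q"
        using generic[OF d1] generic[OF d2] by (auto intro!: UC_C simp: x1_def x2_def)
      moreover have "\<bar>s - t\<bar> \<le> 2 / P" if "\<bar>s - r\<bar> \<le> 1 / P" "\<bar>t - r\<bar> \<le> 1 / P" for s t r P :: real
        using abs_triangle_ineq4[of "s - r" "t - r"] that by (simp add: add_divide_distrib[symmetric])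
      ultimately show ?thesis by (simp add: C_def)
    qed
    have "tnorm (\<gamma> c) (proj ?B (\<lambda>j. \<theta> c x1 j - \<theta> c x2 j)) \<le> l1 (proj ?B (\<lambda>j. \<theta> c x1 j - \<theta> c x2 j))"
      by (intro tnorm_le_l1 g c00_proj_finite) simp
    also have "\<dots> = (\<Sum>j\<in>?B. \<bar>\<theta> c x1 j - \<theta> c x2 j\<bar>)"
      by (subst l1_supset[of ?B]) (auto simp: proj_def)
    also have "\<dots> \<le> (\<Sum>j<b (Suc k). \<bar>\<theta> c x1 j - \<theta> c x2 j\<bar>)"
      by (rule sum_mono2) auto
    also have "\<dots> \<le> (\<Sum>j<b (Suc k). 2 / (real (b (Suc k)) * 2 ^ k + 1))"
      by (rule sum_mono) (use future in simp)
    also have "\<dots> = 2 * real (b (Suc k)) / (real (b (Suc k)) * 2 ^ k + 1)" by simp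
    also have "\<dots> \<le> 2 * (1/2) ^ k"
    proof -
      have pos: "0 < real (b (Suc k)) * 2 ^ k + 1" by (simp add: add_nonneg_pos)
      have "2 * real (b (Suc k)) = 2 * (1/2) ^ k * (real (b (Suc k)) * 2 ^ k)"
        by (simp add: power_divide)
      also have "\<dots> \<le> 2 * (1/2) ^ k * (real (b (Suc k)) * 2 ^ k + 1)"
        by (intro mult_left_mono) auto
      finally show ?thesis unfolding pos_divide_le_eq[OF pos] .
    qed
    finally have future': "tnorm (\<gamma> c) (proj ?B (\<lambda>j. \<theta> c x1 j - \<theta> c x2 j)) \<le> 2 * (1/2) ^ k" .
    have "proj ?B (\<lambda>j. \<theta> c x j - \<theta> c x2 j)
        = (\<lambda>j. proj ?B (\<lambda>j. \<theta> c x j - \<theta> c x1 j) j + proj ?B (\<lambda>j. \<theta> c x1 j - \<theta> c x2 j) j)"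
      by (auto simp: proj_def)
    then have "tnorm (\<gamma> c) (proj ?B (\<lambda>j. \<theta> c x j - \<theta> c x2 j)) \<le>
        tnorm (\<gamma> c) (proj ?B (\<lambda>j. \<theta> c x j - \<theta> c x1 j)) + tnorm (\<gamma> c) (proj ?B (\<lambda>j. \<theta> c x1 j - \<theta> c x2 j))"
      using tnorm_add[OF g[of c] c00_proj_finite c00_proj_finite] by simp
    then have "tnorm (\<gamma> c) (proj ?B (\<lambda>j. \<theta> c x j - \<theta> c x2 j)) \<le> 4 * (1/2) ^ k"
      using past future' by simp
    then show ?thesis by (simp add: x_def x2_def d2_def)
  qed
  show ?thesis
  proof (intro exI conjI allI impI)
    show "branch_point s d i = branch_point s d' i" if "i \<notin> range (free_pos s)" for d d' i
      by (rule branch_point_fixed_pos[OF that])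
    show "strict_mono b" by (rule b)
    show "tnorm (\<gamma> c) (proj {b k..<b (Suc k)} (\<lambda>j. \<theta> c (branch_point s d) j
        - \<theta> c (branch_point s (\<lambda>i. if i = k then d k else 0)) j)) \<le> 4 * (1/2) ^ k"
      if "\<forall>i. d i \<le> i" for c d k
      by (rule error) (use that in blast)
  qed (simp_all add: strict_mono_free_pos branch_point_free_pos)
qed

section \<open>Averages of block vectors\<close>

lemma successive_subset:
  assumes "successive J E" "\<And>j. j \<in> J \<Longrightarrow> E' j \<subseteq> E j"
  shows "successive J E'"
  using assms unfolding successive_def by (meson subsetD)

lemma successive_intervals:
  fixes c :: "nat \<Rightarrow> nat"
  assumes "strict_mono c"
  shows "successive J (\<lambda>l. {c l..<c (Suc l)})"
  unfolding successive_def
proof (intro ballI impI)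
  fix k l x y assume "k < l" "x \<in> {c k..<c (Suc k)}" "y \<in> {c l..<c (Suc l)}"
  moreover have "c (Suc k) \<le> c l" using \<open>k < l\<close> assms by (simp add: strict_mono_less_eq Suc_le_eq)
  ultimately show "x < y" by simp
qed

text \<open>
  Of two successive sets the later one cannot meet an earlier interval than the former, so the pairs
  \<open>(i, l)\<close> for which \<open>E i\<close> meets the \<open>l\<close>-th interval form a chain on which \<open>i + l\<close> is injective.
\<close>

lemma sum_card_intervals_le:
  fixes c :: "nat \<Rightarrow> nat"
  assumes c: "strict_mono c" and E: "successive {..<k} E"
  shows "(\<Sum>i<k. card {l. l < m \<and> E i \<inter> {c l..<c (Suc l)} \<noteq> {}}) \<le> m + k"
proof -
  define L where "L = (\<lambda>i. {l. l < m \<and> E i \<inter> {c l..<c (Suc l)} \<noteq> {}})"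
  have mono: "l \<le> l'" if il: "i < i'" "i' < k" "l \<in> L i" "l' \<in> L i'" for i i' l l'
  proof (rule ccontr)
    assume "\<not> l \<le> l'"
    then have "c (Suc l') \<le> c l" using c by (simp add: strict_mono_less_eq)
    moreover obtain a where "a \<in> E i" "c l \<le> a" using il(3) by (auto simp: L_def)
    moreover obtain a' where "a' \<in> E i'" "a' < c (Suc l')" using il(4) by (auto simp: L_def)
    moreover have "a < a'"
    proof -
      have "i \<in> {..<k}" "i' \<in> {..<k}" using il by auto
      then show ?thesis using E il(1) \<open>a \<in> E i\<close> \<open>a' \<in> E i'\<close> unfolding successive_def by blast
    qed
    ultimately show False by linarith
  qed
  have "inj_on (\<lambda>(i, l). i + l) (SIGMA i:{..<k}. L i)"
  proof (rule inj_onI, clarsimp)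
    fix i l i' l' assume *: "i < k" "l \<in> L i" "i' < k" "l' \<in> L i'" "i + l = i' + l'"
    consider "i < i'" | "i = i'" | "i' < i" by linarith
    then show "i = i' \<and> l = l'"
    proof cases
      case 1 then show ?thesis using mono[of i i' l l'] * by auto
    next
      case 3 then show ?thesis using mono[of i' i l' l] * by auto
    qed (use * in auto)
  qed
  moreover have "(\<lambda>(i, l). i + l) ` (SIGMA i:{..<k}. L i) \<subseteq> {..<m + k}"
    by (auto simp: L_def)
  ultimately have "card (SIGMA i:{..<k}. L i) \<le> m + k"
    using card_inj_on_le[of "\<lambda>(i, l). i + l" _ "{..<m + k}"] by simp
  then show ?thesis by (simp add: L_def)
qed

text \<open>
  The sets \<open>E i\<close> need not lie beyond \<open>k\<close>, so \<open>A\<close> may have to exceed the norm. It is this quantity, and not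
  the norm, that nearly contracts by the factor \<open>\<gamma>\<close> under averaging.
\<close>

definition spread_le :: "real \<Rightarrow> nat \<Rightarrow> real \<Rightarrow> (nat \<Rightarrow> real) \<Rightarrow> bool" where
  "spread_le \<gamma> K A y \<longleftrightarrow>
     (\<forall>k\<le>K. \<forall>E. successive {..<k} E \<longrightarrow> (\<Sum>i<k. tnorm \<gamma> (proj (E i) y)) \<le> A)"

lemma spread_le_norm:
  assumes "spread_le \<gamma> K A y" "1 \<le> K"
  shows "tnorm \<gamma> y \<le> A"
proof -
  have "successive {..<1} (\<lambda>_. UNIV)" by (simp add: successive_def)
  then have "(\<Sum>i<1::nat. tnorm \<gamma> (proj UNIV y)) \<le> A"
    using assms unfolding spread_le_def by blast
  then show ?thesis by (simp add: proj_id)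
qed

lemma admissible_successive:
  assumes "(k, F) \<in> admissible"
  shows "successive {..<k} F"
  using admissible_less[OF assms] by (auto simp: successive_def)

text \<open>
  The norm of a vector supported beyond \<open>K\<close> controls its spread up to the factor \<open>1 / \<gamma>\<close>. This
  factor is lost only once, before the averaging begins.
\<close>

lemma spread_le_far:
  assumes g: "\<gamma> \<in> {0<..<1}" and y: "y \<in> c00" and far: "\<And>n. n < K \<Longrightarrow> y n = 0"
    and A: "tnorm \<gamma> y \<le> A"
  shows "spread_le \<gamma> K (A / \<gamma>) y"
  unfolding spread_le_def
proof (intro allI impI)
  fix k E assume k: "k \<le> K" and E: "successive {..<k} E"
  have "proj (E i) y = proj (E i \<inter> {K..}) y" for i
  proof
    show "proj (E i) y n = proj (E i \<inter> {K..}) y n" for n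
      by (cases "K \<le> n") (simp_all add: proj_def far)
  qed
  moreover have "\<gamma> * (\<Sum>i<k. tnorm \<gamma> (proj (E i \<inter> {K..}) y)) \<le> tnorm \<gamma> y"
  proof (rule tnorm_successive_le[OF g y])
    show "successive {..<k} (\<lambda>i. E i \<inter> {K..})" by (rule successive_subset[OF E]) simp
  qed (use k in auto)
  ultimately show "(\<Sum>i<k. tnorm \<gamma> (proj (E i) y)) \<le> A / \<gamma>"
    using A g by (simp add: field_simps)
qed

lemma sum_blocks:
  fixes c :: "nat \<Rightarrow> nat"
  assumes c: "strict_mono c" and y: "\<And>n. y n \<noteq> 0 \<Longrightarrow> c 0 \<le> n \<and> n < c m"
  shows "y = (\<lambda>n. \<Sum>l<m. proj {c l..<c (Suc l)} y n)"
proof -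
  have "(\<Sum>l<m. proj {c l..<c (Suc l)} y n) = proj {c 0..<c m} y n" for n
  proof (induction m)
    case (Suc m)
    have "c 0 \<le> c m" "c m \<le> c (Suc m)" using c by (simp_all add: strict_mono_less_eq)
    then show ?case using Suc by (auto simp: proj_def)
  qed (simp add: proj_def)
  moreover have "proj {c 0..<c m} y = y" by (rule proj_id) (use y in auto)
  ultimately show ?thesis by auto
qed

text \<open>
  Let \<open>y\<close> be a sum of successive pieces, and test its norm with an admissible family of \<open>k\<close> sets. Pieces
  ending before \<open>k\<close> are not seen. At most one piece straddles \<open>k\<close>, and it contributes at most
  its own norm. All later pieces begin beyond \<open>k\<close>, so their spread bounds their contribution; it is
  multiplied by \<open>\<gamma>\<close>, and it occurs only for pieces that meet \<open>E\<close>.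
\<close>

lemma tnorm_proj_average_le:
  fixes c :: "nat \<Rightarrow> nat"
  assumes g: "\<gamma> \<in> {0<..<1}" and c: "strict_mono c" "1 \<le> c 0" and y: "y \<in> c00"
    and supp: "\<And>n. y n \<noteq> 0 \<Longrightarrow> c 0 \<le> n \<and> n < c m"
    and A: "\<And>l. l < m \<Longrightarrow> spread_le \<gamma> (c l) A (proj {c l..<c (Suc l)} y)" and A0: "0 \<le> A"
  shows "tnorm \<gamma> (proj E y) \<le> A + \<gamma> * A * card {l. l < m \<and> E \<inter> {c l..<c (Suc l)} \<noteq> {}}"
proof -
  define L where "L = {l. l < m \<and> E \<inter> {c l..<c (Suc l)} \<noteq> {}}"
  have L: "finite L" by (simp add: L_def)
  define z where "z = (\<lambda>l. proj {c l..<c (Suc l)} y)"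
  have z: "z l \<in> c00" for l by (simp add: z_def c00_proj y)
  have c1: "1 \<le> c l" for l using c strict_mono_less_eq[OF c(1), of 0 l] by simp
  have zA: "tnorm \<gamma> (z l) \<le> A" if "l < m" for l
    using spread_le_norm[OF A[OF that] c1] by (simp add: z_def)
  have g0: "0 < \<gamma>" using g by simp
  have LA: "0 \<le> \<gamma> * A * card L" using g0 A0 by simp
  show ?thesis
    unfolding L_def[symmetric]
  proof (rule tnorm_leI[OF g c00_proj[OF y]])
    fix n
    show "\<bar>proj E y n\<bar> \<le> A + \<gamma> * A * card L"
    proof (cases "y n = 0")
      case False
      then have "\<bar>\<Sum>l<m. z l n\<bar> = \<bar>y n\<bar>" using sum_blocks[OF c(1), of y m] supp by (simp add: z_def fun_eq_iff)
      have "\<exists>l<m. z l n \<noteq> 0"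
      proof (rule ccontr)
        assume "\<not> (\<exists>l<m. z l n \<noteq> 0)"
        then show False using \<open>\<bar>\<Sum>l<m. z l n\<bar> = \<bar>y n\<bar>\<close> False by simp
      qed
      then obtain l where l: "l < m" "z l n \<noteq> 0" by blast
      then have "z l n = y n" by (simp add: z_def proj_def split: if_splits)
      then have "\<bar>y n\<bar> \<le> A" using abs_le_tnorm[OF g z[of l], of n] zA[OF l(1)] by simp
      then show ?thesis using LA A0 by (simp add: proj_def)
    qed (use LA A0 in \<open>simp add: proj_def\<close>)
  next
    fix k F assume kF: "(k, F) \<in> admissible"
    have kle: "k \<le> a" if "a \<in> F j" "j < k" for a j
    proof -
      have "k \<le> Min (F 0)" "finite (F 0)" using kF that by (auto simp: admissible_def)
      then have "a \<in> F 0 \<Longrightarrow> k \<le> a" using Min_le order_trans by blast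
      moreover obtain a0 where "a0 \<in> F 0" using kF that by (auto simp: admissible_def)
      moreover have "k \<le> a0" using \<open>k \<le> Min (F 0)\<close> \<open>finite (F 0)\<close> Min_le order_trans \<open>a0 \<in> F 0\<close> by blast
      ultimately show ?thesis using admissible_less[OF kF, of 0 j a0 a] that by (cases "j = 0") auto
    qed
    have part: "\<gamma> * (\<Sum>j<k. tnorm \<gamma> (proj (F j) (proj E (z l))))
        \<le> (if c l < k \<and> k < c (Suc l) then A else 0) + (if l \<in> L then \<gamma> * A else 0)" if l: "l < m" for l
    proof -
      consider "c (Suc l) \<le> k" | "c l < k" "k < c (Suc l)" | "k \<le> c l" by linarith
      then show ?thesis
      proof cases
        case 1
        have "proj (F j) (proj E (z l)) = (\<lambda>_. 0)" if "j < k" for j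
        proof (rule proj_null)
          fix n assume "n \<in> F j"
          then have "c (Suc l) \<le> n" using kle[OF _ that] 1 by fastforce
          then show "proj E (z l) n = 0" by (simp add: z_def proj_def)
        qed
        then have "(\<Sum>j<k. tnorm \<gamma> (proj (F j) (proj E (z l)))) = 0" using tnorm_zero[OF g] by simp
        then show ?thesis using A0 g0 by simp
      next
        case 2
        have "\<gamma> * (\<Sum>j<k. tnorm \<gamma> (proj (F j) (proj E (z l)))) \<le> tnorm \<gamma> (proj E (z l))"
          by (rule tnorm_admissible_le[OF g c00_proj[OF z] kF])
        also have "\<dots> \<le> A" using tnorm_proj_le[OF g z] zA[OF l] order_trans by blast
        finally have "\<gamma> * (\<Sum>j<k. tnorm \<gamma> (proj (F j) (proj E (z l)))) \<le> A" .
        moreover have "0 \<le> \<gamma> * A" using A0 g0 by simp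
        ultimately show ?thesis using 2 by simp
      next
        case 3
        show ?thesis
        proof (cases "l \<in> L")
          case True
          have "successive {..<k} (\<lambda>j. F j \<inter> E)"
            by (rule successive_subset[OF admissible_successive[OF kF]]) simp
          then have "(\<Sum>j<k. tnorm \<gamma> (proj (F j \<inter> E) (z l))) \<le> A"
            using A[OF l] 3 unfolding spread_le_def z_def by blast
          then show ?thesis using True g0 A0 3 by (simp add: proj_proj)
        next
          case False
          then have "proj E (z l) = (\<lambda>_. 0)"
            using l by (intro proj_null) (auto simp: L_def z_def proj_def)
          then show ?thesis using False tnorm_zero[OF g] A0 by (simp add: proj_def)
        qed
      qed
    qed
    have "(\<Sum>j<k. tnorm \<gamma> (proj (F j) (proj E y))) \<le> (\<Sum>j<k. \<Sum>l<m. tnorm \<gamma> (proj (F j) (proj E (z l))))"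
    proof (rule sum_mono)
      fix j
      have "proj (F j) (proj E y) = (\<lambda>n. \<Sum>l<m. proj (F j) (proj E (z l)) n)"
        by (subst sum_blocks[OF c(1), of y m]) (simp_all add: supp proj_sum z_def)
      then show "tnorm \<gamma> (proj (F j) (proj E y)) \<le> (\<Sum>l<m. tnorm \<gamma> (proj (F j) (proj E (z l))))"
        using tnorm_sum[OF g, of "{..<m}" "\<lambda>l. proj (F j) (proj E (z l))"] by (simp add: c00_proj z)
    qed
    also have "\<dots> = (\<Sum>l<m. \<Sum>j<k. tnorm \<gamma> (proj (F j) (proj E (z l))))" by (rule sum.swap)
    finally have "\<gamma> * (\<Sum>j<k. tnorm \<gamma> (proj (F j) (proj E y)))
        \<le> \<gamma> * (\<Sum>l<m. \<Sum>j<k. tnorm \<gamma> (proj (F j) (proj E (z l))))"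
      using g0 by simp
    also have "\<dots> = (\<Sum>l<m. \<gamma> * (\<Sum>j<k. tnorm \<gamma> (proj (F j) (proj E (z l)))))"
      by (simp add: sum_distrib_left)
    also have "\<dots> \<le> (\<Sum>l<m. (if c l < k \<and> k < c (Suc l) then A else 0) + (if l \<in> L then \<gamma> * A else 0))"
      by (rule sum_mono) (use part in simp)
    also have "\<dots> = A * card {l. l < m \<and> c l < k \<and> k < c (Suc l)} + \<gamma> * A * card L"
    proof -
      have "(\<Sum>l<m. if c l < k \<and> k < c (Suc l) then A else 0) = A * card {l. l < m \<and> c l < k \<and> k < c (Suc l)}"
        by (simp add: sum.If_cases Int_def conj_ac)
      moreover have "(\<Sum>l<m. if l \<in> L then \<gamma> * A else 0) = \<gamma> * A * card L"
      proof -
        have "{..<m} \<inter> L = L" by (auto simp: L_def)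
        then show ?thesis by (simp add: sum.If_cases)
      qed
      ultimately show ?thesis by (simp add: sum.distrib)
    qed
    also have "\<dots> \<le> A * 1 + \<gamma> * A * card L"
    proof -
      have "l = l'" if "c l < k" "k < c (Suc l)" "c l' < k" "k < c (Suc l')" for l l'
      proof -
        have "c l < c (Suc l')" "c l' < c (Suc l)" using that by linarith+
        then show ?thesis using c(1) by (simp add: strict_mono_less)
      qed
      then have "card {l. l < m \<and> c l < k \<and> k < c (Suc l)} \<le> Suc 0"
        by (intro card_le_Suc0_iff_eq[THEN iffD2]) auto
      then show ?thesis using A0 by (intro add_right_mono mult_left_mono) auto
    qed
    finally show "\<gamma> * (\<Sum>j<k. tnorm \<gamma> (proj (F j) (proj E y))) \<le> A + \<gamma> * A * card L" by simp
  qed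
qed

text \<open>
  The bound of \<open>tnorm_proj_average_le\<close> is summed over \<open>K\<close> successive sets. By \<open>sum_card_intervals_le\<close>
  they meet the pieces at most \<open>m + K\<close> times in total, which gives \<open>A (\<gamma> m + 2 K)\<close>; the second term is
  negligible when \<open>m\<close> is large compared with \<open>K\<close>.
\<close>

lemma spread_le_average:
  fixes c :: "nat \<Rightarrow> nat"
  assumes g: "\<gamma> \<in> {0<..<1}" and c: "strict_mono c" "1 \<le> c 0" and y: "y \<in> c00"
    and supp: "\<And>n. y n \<noteq> 0 \<Longrightarrow> c 0 \<le> n \<and> n < c m"
    and A: "\<And>l. l < m \<Longrightarrow> spread_le \<gamma> (c l) A (proj {c l..<c (Suc l)} y)" and A0: "0 \<le> A"
    and K: "2 * real K \<le> (\<delta>::real) * m"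
  shows "spread_le \<gamma> K (A * m * (\<gamma> + \<delta>)) y"
  unfolding spread_le_def
proof (intro allI impI)
  fix k E assume k: "k \<le> K" and E: "successive {..<k} E"
  have "(\<Sum>i<k. tnorm \<gamma> (proj (E i) y))
      \<le> (\<Sum>i<k. A + \<gamma> * A * card {l. l < m \<and> E i \<inter> {c l..<c (Suc l)} \<noteq> {}})"
    by (rule sum_mono) (rule tnorm_proj_average_le[OF g c y supp A A0])
  also have "\<dots> = k * A + \<gamma> * A * real (\<Sum>i<k. card {l. l < m \<and> E i \<inter> {c l..<c (Suc l)} \<noteq> {}})"
    by (simp add: sum.distrib sum_distrib_left)
  also have "\<dots> \<le> k * A + \<gamma> * A * real (m + k)"
    using sum_card_intervals_le[OF c(1) E, of m] g A0
    by (intro add_left_mono mult_left_mono) (simp_all only: of_nat_le_iff, auto)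
  also have "\<dots> = A * (k + \<gamma> * k + \<gamma> * m)" by (simp add: algebra_simps)
  also have "\<dots> \<le> A * (2 * K + \<gamma> * m)"
  proof (intro mult_left_mono add_right_mono A0)
    have "\<gamma> * real k \<le> 1 * real k" using g by (intro mult_right_mono) auto
    then show "real k + \<gamma> * real k \<le> real (2 * K)" using k by simp
  qed
  also have "\<dots> \<le> A * (\<delta> * m + \<gamma> * m)" using K by (intro mult_left_mono add_right_mono A0) simp
  finally show "(\<Sum>i<k. tnorm \<gamma> (proj (E i) y)) \<le> A * m * (\<gamma> + \<delta>)" by (simp add: algebra_simps)
qed

text \<open>
  A subset of least cardinality reaching the sum \<open>\<tau>\<close> falls below \<open>\<tau>\<close> when one element is
  removed. Any \<open>n \<ge> \<tau> / \<delta>\<close> bounds its cardinality, wherever in \<open>A\<close> it is sought, so it may be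
  sought beyond \<open>n\<close>.
\<close>

lemma greedy_subset:
  fixes f :: "nat \<Rightarrow> real"
  assumes A: "infinite A" and f: "\<And>k. k \<in> A \<Longrightarrow> \<delta> \<le> f k \<and> f k \<le> \<nu>" and "0 < \<delta>" "0 < \<tau>"
  obtains B where "B \<subseteq> A" "finite B" "\<And>k. k \<in> B \<Longrightarrow> N \<le> k \<and> card B \<le> k" "\<tau> \<le> sum f B" "sum f B \<le> \<tau> + \<nu>"
proof -
  obtain n :: nat where n: "\<tau> / \<delta> \<le> n" using real_arch_simple by blast
  have inf: "infinite (A - {..<max N n})" using A by simp
  define P where "P = (\<lambda>B. B \<subseteq> A - {..<max N n} \<and> finite B \<and> \<tau> \<le> sum f B)"
  obtain C where C: "C \<subseteq> A - {..<max N n}" "finite C" "card C = n"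
    using infinite_arbitrarily_large[OF inf] by blast
  have "n * \<delta> \<le> sum f C"
    using sum_mono[of C "\<lambda>_. \<delta>" f] C f by (auto simp: mult.commute)
  then have "P C" using n C assms by (auto simp: P_def field_simps)
  then obtain B where B: "P B" "\<And>B'. P B' \<Longrightarrow> card B \<le> card B'"
    using ex_has_least_nat[of P C card] by blast
  have "B \<noteq> {}" using B assms by (auto simp: P_def)
  then obtain x where x: "x \<in> B" by blast
  have "\<not> P (B - {x})"
    using B(2)[of "B - {x}"] x B(1) card_Diff1_less[of B x] by (auto simp: P_def)
  then have "sum f (B - {x}) < \<tau>" using B(1) by (auto simp: P_def)
  then have "sum f B \<le> \<tau> + \<nu>"
    using x B(1) f[of x] by (auto simp: P_def sum.remove)
  moreover have "card B \<le> n" using B(2)[OF \<open>P C\<close>] C by simp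
  ultimately show ?thesis using B(1) by (intro that[of B]) (auto simp: P_def)
qed

section \<open>Gluing choices of digits\<close>

text \<open>
  The sum of the block vectors \<open>H k (d k)\<close>. It suffices to let \<open>k\<close> range up to \<open>j\<close>, because the \<open>k\<close>-th
  block will start at \<open>b k \<ge> k\<close>.
\<close>

definition block_sum :: "(nat \<Rightarrow> nat \<Rightarrow> nat \<Rightarrow> real) \<Rightarrow> (nat \<Rightarrow> nat) \<Rightarrow> nat \<Rightarrow> real" where
  "block_sum H d j = (\<Sum>k\<le>j. H k (d k) j)"

lemma block_sum_in_block:
  fixes b :: "nat \<Rightarrow> nat"
  assumes b: "strict_mono b" and supp: "\<And>k i j. H k i j \<noteq> 0 \<Longrightarrow> b k \<le> j \<and> j < b (Suc k)"
    and j: "b k \<le> j" "j < b (Suc k)"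
  shows "block_sum H d j = H k (d k) j"
proof -
  have "H k' (d k') j = 0" if "k' \<noteq> k" for k'
  proof (rule ccontr)
    assume "H k' (d k') j \<noteq> 0"
    then have "b k < b (Suc k')" "b k' < b (Suc k)" using j supp[of k' "d k'" j] by linarith+
    then show False using that b by (simp add: strict_mono_less)
  qed
  then have "(\<Sum>k'\<le>j. H k' (d k') j) = (\<Sum>k'\<in>{k}. H k' (d k') j)"
    using j strict_mono_imp_increasing[OF b, of k] by (intro sum.mono_neutral_right) auto
  then show ?thesis by (simp add: block_sum_def)
qed

text \<open>
  The choice of digits that follows \<open>ds l\<close> on the \<open>l\<close>-th of a sequence of consecutive intervals, provided
  that \<open>ds l\<close> vanishes outside this interval: at most one summand is then different from \<open>0\<close>.
\<close>

definition glue :: "(nat \<Rightarrow> nat \<Rightarrow> nat) \<Rightarrow> nat \<Rightarrow> nat" where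
  "glue ds k = (\<Sum>l\<le>k. ds l k)"

definition digits_in :: "(nat \<Rightarrow> nat) \<Rightarrow> nat \<Rightarrow> nat \<Rightarrow> bool" where
  "digits_in d p q \<longleftrightarrow> (\<forall>k. d k \<le> k \<and> (d k \<noteq> 0 \<longrightarrow> p \<le> k \<and> k < q))"

lemma digits_in_mono: "digits_in d p q \<Longrightarrow> p' \<le> p \<Longrightarrow> q \<le> q' \<Longrightarrow> digits_in d p' q'"
  unfolding digits_in_def by (meson le_trans less_le_trans)

lemma glue_block:
  assumes N: "strict_mono N" and ds: "\<And>l. digits_in (ds l) (N l) (N (Suc l))"
    and k: "N l \<le> k" "k < N (Suc l)"
  shows "glue ds k = ds l k"
proof -
  have "l \<le> k" using strict_mono_imp_increasing[OF N, of l] k by simp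
  have "ds l' k = 0" if "l' \<noteq> l" for l'
  proof (rule ccontr)
    assume "ds l' k \<noteq> 0"
    then have "N l' \<le> k" "k < N (Suc l')" using ds[of l'] by (auto simp: digits_in_def)
    then have "N l < N (Suc l')" "N l' < N (Suc l)" using k by linarith+
    then show False using that N by (simp add: strict_mono_less)
  qed
  then have "(\<Sum>l'\<le>k. ds l' k) = (\<Sum>l'\<in>{l}. ds l' k)"
    using \<open>l \<le> k\<close> by (intro sum.mono_neutral_right) auto
  then show ?thesis by (simp add: glue_def)
qed

lemma glue_nonzero:
  assumes "glue ds k \<noteq> 0"
  obtains l where "ds l k \<noteq> 0"
  using assms unfolding glue_def by (meson sum.not_neutral_contains_not_neutral)

lemma glue_nonzero_block:
  assumes N: "strict_mono N" and ds: "\<And>l. digits_in (ds l) (N l) (N (Suc l))" and "glue ds k \<noteq> 0"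
  obtains l where "N l \<le> k" "k < N (Suc l)" "glue ds k = ds l k"
proof -
  obtain l where "ds l k \<noteq> 0" using assms(3) by (rule glue_nonzero)
  then have "N l \<le> k" "k < N (Suc l)" using ds[of l] by (auto simp: digits_in_def)
  then show ?thesis using that glue_block[OF N ds] by blast
qed

lemma glue_le:
  assumes N: "strict_mono N" and ds: "\<And>l. digits_in (ds l) (N l) (N (Suc l))"
  shows "glue ds k \<le> k"
proof (cases "glue ds k = 0")
  case False
  then obtain l where "glue ds k = ds l k" using glue_nonzero_block[OF N ds] by metis
  then show ?thesis using ds[of l] by (simp add: digits_in_def)
qed simp

lemma glue_sequence:
  assumes "\<And>s p. \<exists>d q. p < q \<and> digits_in d p q \<and> P s p d"
  obtains ds N where "strict_mono N" "N 0 = start" "\<And>l. digits_in (ds l) (N l) (N (Suc l))" "\<And>l. P l (N l) (ds l)"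
proof -
  obtain D Q where DQ: "\<And>s p. p < Q s p" "\<And>s p. digits_in (D s p) p (Q s p)" "\<And>s p. P s p (D s p)"
  proof -
    have "\<forall>s p. \<exists>x. p < snd x \<and> digits_in (fst x) p (snd x) \<and> P s p (fst x)"
      using assms by simp
    then have "\<exists>F. \<forall>s p. p < snd (F s p) \<and> digits_in (fst (F s p)) p (snd (F s p)) \<and> P s p (fst (F s p))"
      by (intro choice allI) blast
    then obtain F where "\<forall>s p. p < snd (F s p) \<and> digits_in (fst (F s p)) p (snd (F s p)) \<and> P s p (fst (F s p))" ..
    then show ?thesis by (intro that[of "\<lambda>s p. snd (F s p)" "\<lambda>s p. fst (F s p)"]) simp_all
  qed
  define N where "N = rec_nat start Q"
  have N: "N 0 = start" "N (Suc l) = Q l (N l)" for l by (simp_all add: N_def)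
  show ?thesis
    by (rule that[of N "\<lambda>l. D l (N l)"]) (use DQ N in \<open>auto simp: strict_mono_Suc_iff\<close>)
qed

section \<open>Pairs of block systems\<close>

definition constant_digits :: "nat set \<Rightarrow> nat \<Rightarrow> nat \<Rightarrow> nat" where
  "constant_digits B i k = (if k \<in> B then i else 0)"

text \<open>
  What is left of a Schauder equivalence relation and of its two reductions. Convergence of the
  series of blocks plays the part of equivalence to the zero choice: a digit repeated infinitely often
  gives a series whose terms do not tend to \<open>0\<close>, and digits that are all different give
  an absolutely convergent series.
\<close>

locale block_system =
  fixes \<gamma> :: "bool \<Rightarrow> real" and H :: "bool \<Rightarrow> nat \<Rightarrow> nat \<Rightarrow> nat \<Rightarrow> real" and b :: "nat \<Rightarrow> nat"
  assumes g: "\<gamma> c \<in> {0<..<1}"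
    and b: "strict_mono b"
    and H_supp: "H c k i j \<noteq> 0 \<Longrightarrow> b k \<le> j \<and> j < b (Suc k)"
    and H_zero: "H c k 0 j = 0"
    and agree: "(\<And>k. d k \<le> k) \<Longrightarrow>
      tail_cauchy (\<gamma> True) (block_sum (H True) d) \<longleftrightarrow> tail_cauchy (\<gamma> False) (block_sum (H False) d)"
    and constant_diverges: "(\<And>k. d k \<le> k) \<Longrightarrow> 1 \<le> i \<Longrightarrow> infinite {k. d k = i} \<Longrightarrow>
      \<not> tail_cauchy (\<gamma> False) (block_sum (H False) d)"
    and injective_converges: "(\<And>k. d k \<le> k) \<Longrightarrow> inj_on d {k. d k \<noteq> 0} \<Longrightarrow>
      tail_cauchy (\<gamma> False) (block_sum (H False) d)"
begin

abbreviation nrm :: "bool \<Rightarrow> (nat \<Rightarrow> real) \<Rightarrow> real" where "nrm c \<equiv> tnorm (\<gamma> c)"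
abbreviation vec :: "bool \<Rightarrow> (nat \<Rightarrow> nat) \<Rightarrow> nat \<Rightarrow> real" where "vec c \<equiv> block_sum (H c)"

lemma g0: "0 < \<gamma> c" using g[of c] by simp

lemma b_ge: "k \<le> b k" by (rule strict_mono_imp_increasing[OF b])

lemma b_less_iff: "b k < b l \<longleftrightarrow> k < l" and b_le_iff: "b k \<le> b l \<longleftrightarrow> k \<le> l"
  using b by (simp_all add: strict_mono_less strict_mono_less_eq)

lemma vec_in_block:
  assumes "b k \<le> j" "j < b (Suc k)"
  shows "vec c d j = H c k (d k) j"
  by (rule block_sum_in_block[OF b _ assms]) (rule H_supp)

lemma vec_nonzero:
  assumes "vec c d j \<noteq> 0"
  obtains k where "b k \<le> j" "j < b (Suc k)" "vec c d j = H c k (d k) j" "d k \<noteq> 0"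
proof -
  obtain k where k: "H c k (d k) j \<noteq> 0"
    using assms unfolding block_sum_def by (meson sum.not_neutral_contains_not_neutral)
  then have "b k \<le> j" "j < b (Suc k)" using H_supp by blast+
  moreover have "d k \<noteq> 0" using k H_zero[of c k j] by metis
  ultimately show ?thesis using that vec_in_block by blast
qed

lemma vec_support:
  assumes "digits_in d p q" "vec c d j \<noteq> 0"
  shows "b p \<le> j \<and> j < b q"
proof -
  obtain k where k: "b k \<le> j" "j < b (Suc k)" "d k \<noteq> 0" using assms(2) by (rule vec_nonzero)
  then have "p \<le> k" "Suc k \<le> q" using assms(1) by (auto simp: digits_in_def Suc_le_eq)
  then have "b p \<le> b k" "b (Suc k) \<le> b q" by (simp_all add: b_le_iff)
  then show ?thesis using k by linarith
qed

lemma vec_c00: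
  assumes "digits_in d p q"
  shows "vec c d \<in> c00"
proof -
  have "{j. vec c d j \<noteq> 0} \<subseteq> {..<b q}" using vec_support[OF assms] by auto
  then show ?thesis unfolding c00_def by (auto intro: finite_subset)
qed

lemma H_c00: "H c k i \<in> c00"
proof -
  have "{j. H c k i j \<noteq> 0} \<subseteq> {..<b (Suc k)}" using H_supp by auto
  then show ?thesis unfolding c00_def by (auto intro: finite_subset)
qed

lemma proj_vec_block: "proj {b k..<b (Suc k)} (vec c d) = H c k (d k)"
  using vec_in_block H_supp[of c k "d k"] by (fastforce simp: proj_def)

lemma proj_vec:
  assumes "digits_in e p q" and eq: "\<And>k. p \<le> k \<Longrightarrow> k < q \<Longrightarrow> d k = e k"
  shows "proj {b p..<b q} (vec c d) = vec c e"
proof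
  fix j
  show "proj {b p..<b q} (vec c d) j = vec c e j"
  proof (cases "b p \<le> j \<and> j < b q")
    case True
    have inblock: "vec c d j = vec c e j" if "b k \<le> j" "j < b (Suc k)" for k
    proof -
      have "b p < b (Suc k)" "b k < b q" using True that by linarith+
      then have "d k = e k" by (intro eq) (simp_all add: b_less_iff)
      then show ?thesis using vec_in_block[OF that] by simp
    qed
    have "vec c d j = vec c e j"
    proof (cases "vec c d j = 0 \<and> vec c e j = 0")
      case False
      then show ?thesis using vec_nonzero inblock by metis
    qed simp
    then show ?thesis using True by (simp add: proj_def)
  next
    case False
    then have "vec c e j = 0" using vec_support[OF assms(1)] by blast
    then show ?thesis using False by (auto simp: proj_def)
  qed
qed

lemma proj_vec_glue:
  assumes "strict_mono N" "\<And>l. digits_in (ds l) (N l) (N (Suc l))"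
  shows "proj {b (N l)..<b (N (Suc l))} (vec c (glue ds)) = vec c (ds l)"
  by (rule proj_vec[OF assms(2)]) (rule glue_block[OF assms])

lemma glue_converges:
  assumes N: "strict_mono N" and ds: "\<And>l. digits_in (ds l) (N l) (N (Suc l))"
    and \<epsilon>: "summable \<epsilon>" "\<And>l. nrm c (vec c (ds l)) \<le> \<epsilon> l"
  shows "tail_cauchy (\<gamma> c) (vec c (glue ds))"
proof (rule tail_cauchy_blocks[OF g _ \<epsilon>(1), of "\<lambda>l. b (N l)"])
  show "strict_mono (\<lambda>l. b (N l))" using b N by (simp add: strict_mono_def)
qed (simp add: proj_vec_glue[OF N ds] \<epsilon>(2))

lemma glue_diverges:
  assumes N: "strict_mono N" and ds: "\<And>l. digits_in (ds l) (N l) (N (Suc l))"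
    and \<epsilon>: "0 < \<epsilon>" "\<And>l. \<epsilon> < nrm c (vec c (ds l))"
  shows "\<not> tail_cauchy (\<gamma> c) (vec c (glue ds))"
proof (rule not_tail_cauchyI[OF g \<epsilon>(1)])
  fix k
  have "k \<le> b (N k)" using strict_mono_imp_increasing[OF N, of k] b_ge[of "N k"] by linarith
  then show "\<exists>l m. k \<le> l \<and> \<epsilon> < nrm c (proj {l..<m} (vec c (glue ds)))"
    using \<epsilon>(2)[of k] proj_vec_glue[OF N ds, of k c] by metis
qed

lemma tail_cauchy_agree:
  assumes "\<And>k. d k \<le> k"
  shows "tail_cauchy (\<gamma> c) (vec c d) \<longleftrightarrow> tail_cauchy (\<gamma> c') (vec c' d)"
  using agree[OF assms] by (cases c; cases c') auto

text \<open>
  Otherwise there are, arbitrarily far out, choices of digits whose vectors have summable norms in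
  one space and norms above \<open>\<epsilon>\<close> in the other; glued together they give a series that converges in
  the first space and diverges in the second.
\<close>

lemma uniform_transfer:
  assumes "0 < \<epsilon>"
  obtains \<eta> p where "0 < \<eta>" "\<And>d q. digits_in d p q \<Longrightarrow> nrm c (vec c d) \<le> \<eta> \<Longrightarrow> nrm c' (vec c' d) \<le> \<epsilon>"
proof (rule ccontr)
  assume neg: "\<not> thesis"
  have "\<exists>d q. p < q \<and> digits_in d p q \<and> nrm c (vec c d) \<le> (1/2) ^ s \<and> \<epsilon> < nrm c' (vec c' d)" for s p
  proof (rule ccontr)
    assume *: "\<not> ?thesis"
    show False
    proof (rule notE[OF neg], rule that)
      show "0 < (1/2 :: real) ^ s" by simp
      show "nrm c' (vec c' d) \<le> \<epsilon>" if "digits_in d p q" "nrm c (vec c d) \<le> (1/2) ^ s" for d q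
      proof (rule ccontr)
        assume "\<not> ?thesis"
        moreover have "digits_in d p (max q (Suc p))" by (rule digits_in_mono[OF that(1)]) auto
        moreover have "p < max q (Suc p)" by simp
        ultimately show False using * that(2) not_le by blast
      qed
    qed
  qed
  then obtain ds N where N: "strict_mono N" and "N 0 = 0" and ds: "\<And>l. digits_in (ds l) (N l) (N (Suc l))"
    and P: "\<And>l. nrm c (vec c (ds l)) \<le> (1/2) ^ l \<and> \<epsilon> < nrm c' (vec c' (ds l))"
    by (rule glue_sequence[where start = 0 and P = "\<lambda>s p d. nrm c (vec c d) \<le> (1/2) ^ s \<and> \<epsilon> < nrm c' (vec c' d)"]) (rule that)
  have "tail_cauchy (\<gamma> c) (vec c (glue ds))"
    by (rule glue_converges[OF N ds, where \<epsilon> = "\<lambda>l. (1/2) ^ l"]) (use P summable_geometric[of "1/2 :: real"] in auto)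
  moreover have "\<not> tail_cauchy (\<gamma> c') (vec c' (glue ds))"
    by (rule glue_diverges[OF N ds assms]) (use P in blast)
  ultimately show False using tail_cauchy_agree[of "glue ds" c c', OF glue_le[OF N ds]] by blast
qed

lemma digits_in_constant:
  assumes "finite B" "\<And>k. k \<in> B \<Longrightarrow> p \<le> k \<and> i \<le> k"
  obtains q where "p < q" "digits_in (constant_digits B i) p q"
proof -
  obtain q where "\<And>k. k \<in> B \<Longrightarrow> k < q" using assms(1) unfolding finite_nat_set_iff_bounded by blast
  then have "digits_in (constant_digits B i) p (max q (Suc p))"
    using assms(2) by (auto simp: digits_in_def constant_digits_def less_max_iff_disj)
  then show ?thesis by (intro that[of "max q (Suc p)"]) auto
qed

lemma digits_in_single:
  assumes "p \<le> k" "i \<le> k"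
  shows "p < Suc k \<and> digits_in (constant_digits {k} i) p (Suc k)"
  using assms by (auto simp: digits_in_def constant_digits_def)

lemma vec_single: "vec c (constant_digits {k} i) = H c k i"
proof
  fix j
  show "vec c (constant_digits {k} i) j = H c k i j"
  proof (cases "b k \<le> j \<and> j < b (Suc k)")
    case True
    then show ?thesis using vec_in_block[of k j c] by (simp add: constant_digits_def)
  next
    case False
    have "vec c (constant_digits {k} i) j = 0"
    proof (rule ccontr)
      assume "vec c (constant_digits {k} i) j \<noteq> 0"
      then obtain k' where "b k' \<le> j" "j < b (Suc k')" "constant_digits {k} i k' \<noteq> 0" by (rule vec_nonzero)
      then show False using False by (auto simp: constant_digits_def split: if_splits)
    qed
    then show ?thesis using False H_supp by metis
  qed
qed

text \<open>
  If short blocks of the digit \<open>i\<close> could be found arbitrarily far out, a series of them would converge,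
  although it repeats the digit \<open>i\<close> infinitely often.
\<close>

lemma digits_bounded_below:
  assumes "1 \<le> i"
  obtains \<delta> K where "0 < \<delta>" "\<And>k. K \<le> k \<Longrightarrow> \<delta> \<le> nrm False (H False k i)"
proof (rule ccontr)
  assume neg: "\<not> thesis"
  have "\<exists>d q. p < q \<and> digits_in d p q \<and> nrm False (vec False d) \<le> (1/2) ^ s \<and> (\<exists>k\<ge>p. d k = i)" for s p
  proof -
    have "\<exists>k\<ge>max p i. nrm False (H False k i) < (1/2) ^ s"
    proof (rule ccontr)
      assume "\<not> ?thesis"
      then have "(1/2) ^ s \<le> nrm False (H False k i)" if "max p i \<le> k" for k using that not_le by blast
      then show False using neg that[of "(1/2) ^ s" "max p i"] by simp
    qed
    then obtain k where k: "max p i \<le> k" "nrm False (H False k i) < (1/2) ^ s" by blast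
    have "p < Suc k \<and> digits_in (constant_digits {k} i) p (Suc k)"
      by (rule digits_in_single) (use k in simp_all)
    moreover have "\<exists>k'\<ge>p. constant_digits {k} i k' = i" using k by (intro exI[of _ k]) (simp add: constant_digits_def)
    ultimately show ?thesis using k(2) vec_single[of False k i] less_imp_le by metis
  qed
  then obtain ds N where N: "strict_mono N" and "N 0 = 0" and ds: "\<And>l. digits_in (ds l) (N l) (N (Suc l))"
    and P: "\<And>l. nrm False (vec False (ds l)) \<le> (1/2) ^ l \<and> (\<exists>k\<ge>N l. ds l k = i)"
    by (rule glue_sequence[where start = 0 and P = "\<lambda>s p d. nrm False (vec False d) \<le> (1/2) ^ s \<and> (\<exists>k\<ge>p. d k = i)"]) (rule that)
  have "tail_cauchy (\<gamma> False) (vec False (glue ds))"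
    by (rule glue_converges[OF N ds, where \<epsilon> = "\<lambda>l. (1/2) ^ l"]) (use P summable_geometric[of "1/2 :: real"] in auto)
  moreover have "infinite {k. glue ds k = i}"
    unfolding infinite_nat_iff_unbounded_le
  proof
    fix m
    obtain k where k: "N m \<le> k" "ds m k = i" using P by blast
    then have "k < N (Suc m)" using ds[of m] assms by (auto simp: digits_in_def)
    then have "glue ds k = i" using glue_block[OF N ds] k by metis
    moreover have "m \<le> k" using strict_mono_imp_increasing[OF N, of m] k by simp
    ultimately show "\<exists>n\<ge>m. n \<in> {k. glue ds k = i}" by blast
  qed
  ultimately show False using constant_diverges[of "glue ds" i, OF glue_le[OF N ds] assms] by blast
qed

text \<open>
  If the blocks of every digit \<open>i \<ge> 1\<close> were eventually longer than \<open>\<nu>\<close>, a series using every digit once,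
  sufficiently far out, would diverge, although its digits are all different.
\<close>

lemma small_digit:
  assumes "0 < \<nu>"
  obtains i where "1 \<le> i" "infinite {k. nrm False (H False k i) \<le> \<nu>}"
proof (rule ccontr)
  assume neg: "\<not> thesis"
  have "\<exists>d q. p < q \<and> digits_in d p q \<and> \<nu> / 2 < nrm False (vec False d) \<and>
      (\<exists>k. d = constant_digits {k} (Suc s))" for s p
  proof -
    have "finite {k. nrm False (H False k (Suc s)) \<le> \<nu>}" using neg that[of "Suc s"] by auto
    then obtain n where n: "\<And>k. nrm False (H False k (Suc s)) \<le> \<nu> \<Longrightarrow> k < n"
      unfolding finite_nat_set_iff_bounded by blast
    define k where "k = max n (max p (Suc s))"
    have "\<not> k < n" by (simp add: k_def)
    then have "\<nu> / 2 < nrm False (H False k (Suc s))" using n[of k] assms by linarith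
    moreover have "p < Suc k \<and> digits_in (constant_digits {k} (Suc s)) p (Suc k)"
      by (rule digits_in_single) (simp_all add: k_def)
    ultimately show ?thesis using vec_single[of False k "Suc s"] by metis
  qed
  then obtain ds N where N: "strict_mono N" and "N 0 = 0" and ds: "\<And>l. digits_in (ds l) (N l) (N (Suc l))"
    and P: "\<And>l. \<nu> / 2 < nrm False (vec False (ds l)) \<and> (\<exists>k. ds l = constant_digits {k} (Suc l))"
    by (rule glue_sequence[where start = 0 and P = "\<lambda>s p d. \<nu> / 2 < nrm False (vec False d) \<and> (\<exists>k. d = constant_digits {k} (Suc s))"]) (rule that)
  have "\<not> tail_cauchy (\<gamma> False) (vec False (glue ds))"
    by (rule glue_diverges[OF N ds, of "\<nu> / 2"]) (use P assms in auto)
  moreover have "inj_on (glue ds) {k. glue ds k \<noteq> 0}"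
  proof (rule inj_onI)
    fix k k' assume *: "k \<in> {k. glue ds k \<noteq> 0}" "k' \<in> {k. glue ds k \<noteq> 0}" "glue ds k = glue ds k'"
    obtain l where l: "glue ds k = ds l k" using * glue_nonzero_block[OF N ds] by blast
    obtain l' where l': "glue ds k' = ds l' k'" using * glue_nonzero_block[OF N ds] by blast
    obtain m where m: "ds l = constant_digits {m} (Suc l)" using P by blast
    obtain m' where m': "ds l' = constant_digits {m'} (Suc l')" using P by blast
    have k: "k = m" "ds l k = Suc l" using * l m by (auto simp: constant_digits_def split: if_splits)
    have "k' = m'" "ds l' k' = Suc l'" using * l' m' by (auto simp: constant_digits_def split: if_splits)
    then have "l = l'" using * l l' k by simp
    then have "constant_digits {m} (Suc l) k' \<noteq> 0" using \<open>ds l' k' = Suc l'\<close> m by simp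
    then show "k = k'" using k by (simp add: constant_digits_def split: if_splits)
  qed
  ultimately show False using injective_converges[of "glue ds", OF glue_le[OF N ds]] by blast
qed

lemma nrm_constant_ge:
  assumes B: "finite B" "\<And>k. k \<in> B \<Longrightarrow> i \<le> k \<and> card B \<le> k"
  shows "\<gamma> c * (\<Sum>k\<in>B. nrm c (H c k i)) \<le> nrm c (vec c (constant_digits B i))"
proof -
  obtain q where q: "digits_in (constant_digits B i) 0 q"
    using digits_in_constant[of B 0 i] B by auto
  have "\<gamma> c * (\<Sum>k\<in>B. nrm c (proj {b k..<b (Suc k)} (vec c (constant_digits B i)))) \<le> nrm c (vec c (constant_digits B i))"
  proof (rule tnorm_successive_le[OF g vec_c00[OF q] B(1)])
    show "successive B (\<lambda>k. {b k..<b (Suc k)})"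
      by (rule successive_intervals) (rule b)
    show "card B \<le> a" if "j \<in> B" "a \<in> {b j..<b (Suc j)}" for j a
      using B(2)[OF that(1)] b_ge[of j] that(2) by simp
  qed
  then show ?thesis by (simp add: proj_vec_block constant_digits_def)
qed

lemma nrm_constant_le:
  assumes B: "finite B" "\<And>k. k \<in> B \<Longrightarrow> i \<le> k"
  shows "nrm c (vec c (constant_digits B i)) \<le> (\<Sum>k\<in>B. nrm c (H c k i))"
proof -
  have "vec c (constant_digits B i) j = (\<Sum>k\<in>B. H c k i j)" for j
  proof -
    have "(\<Sum>k\<in>B. H c k i j) = (\<Sum>k\<in>B \<inter> {..j}. H c k i j)"
    proof (rule sum.mono_neutral_right[OF B(1)])
      show "\<forall>k\<in>B - B \<inter> {..j}. H c k i j = 0" using H_supp b_ge order_trans by fastforce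
    qed auto
    also have "\<dots> = (\<Sum>k\<in>B \<inter> {..j}. H c k (constant_digits B i k) j)"
      by (rule sum.cong) (auto simp: constant_digits_def)
    also have "\<dots> = (\<Sum>k\<le>j. H c k (constant_digits B i k) j)"
      by (rule sum.mono_neutral_left) (auto simp: constant_digits_def H_zero)
    finally show ?thesis by (simp add: block_sum_def)
  qed
  then have "vec c (constant_digits B i) = (\<lambda>j. \<Sum>k\<in>B. H c k i j)" by blast
  then show ?thesis using tnorm_sum[OF g, of B "\<lambda>k. H c k i" c] H_c00 by simp
qed

text \<open>
  A digit with short blocks, used in sufficiently many places, yields a vector whose norm in
  \<open>T\<^sub>\<beta>\<close> is controlled by the sum of the norms of its blocks, both from above and, because it has few
  blocks compared with their position, from below. The only problem is that the corresponding blocks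
  in \<open>T\<^sub>\<alpha>\<close> might be much shorter. If this happened for almost all places, blocks with total length about \<open>1\<close>
  in \<open>T\<^sub>\<beta>\<close> would have total length below \<open>\<eta>\<close> in \<open>T\<^sub>\<alpha>\<close>, against \<open>uniform_transfer\<close>.
\<close>

lemma base_step:
  obtains c0 where "0 < c0" "\<And>\<mu> p. 0 < \<mu> \<Longrightarrow> \<mu> \<le> 1 \<Longrightarrow>
     \<exists>d q. p < q \<and> digits_in d p q \<and> nrm False (vec False d) \<le> \<mu> \<and> c0 * \<mu> \<le> nrm True (vec True d)"
proof -
  have "0 < \<gamma> False / 2" using g0 by simp
  then obtain \<eta> p0 where \<eta>: "0 < \<eta>"
    and transfer: "\<And>d q. digits_in d p0 q \<Longrightarrow> nrm True (vec True d) \<le> \<eta> \<Longrightarrow> nrm False (vec False d) \<le> \<gamma> False / 2"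
    using uniform_transfer[of "\<gamma> False / 2" True False] by metis
  define c0 where "c0 = \<gamma> True * \<eta> / 4"
  have "\<exists>d q. p < q \<and> digits_in d p q \<and> nrm False (vec False d) \<le> \<mu> \<and> c0 * \<mu> \<le> nrm True (vec True d)"
    if \<mu>: "0 < \<mu>" "\<mu> \<le> 1" for \<mu> p
  proof -
    obtain i where i: "1 \<le> i" "infinite {k. nrm False (H False k i) \<le> \<mu> / 2}"
      using small_digit[of "\<mu> / 2"] \<mu> by auto
    obtain \<delta> K where \<delta>: "0 < \<delta>" "\<And>k. K \<le> k \<Longrightarrow> \<delta> \<le> nrm False (H False k i)"
      using digits_bounded_below[OF i(1)] by blast
    define A where "A = {k. nrm False (H False k i) \<le> \<mu> / 2} - {..<K}"
    have A: "infinite A" using i(2) by (simp add: A_def)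
    have f: "\<delta> \<le> nrm False (H False k i) \<and> nrm False (H False k i) \<le> \<mu> / 2" if "k \<in> A" for k
      using that \<delta>(2) by (simp add: A_def)
    (* The places where the two blocks of the digit i have comparable norms. *)
    define R where "R = {k \<in> A. \<eta> / 2 * nrm False (H False k i) \<le> nrm True (H True k i)}"
    have R: "infinite R"
    proof
      assume "finite R"
      then have "infinite (A - R)" using A by simp
      then obtain B where B: "B \<subseteq> A - R" "finite B" "\<And>k. k \<in> B \<Longrightarrow> max p0 i \<le> k \<and> card B \<le> k"
        "1 \<le> (\<Sum>k\<in>B. nrm False (H False k i))" "(\<Sum>k\<in>B. nrm False (H False k i)) \<le> 1 + \<mu> / 2"
        using greedy_subset[of "A - R" \<delta> "\<lambda>k. nrm False (H False k i)" "\<mu> / 2" 1 "max p0 i"] f \<delta>(1)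
        by (metis Diff_iff zero_less_one)
      obtain q where q: "digits_in (constant_digits B i) p0 q"
        using digits_in_constant[of B p0 i] B(2,3) by auto
      have "nrm True (vec True (constant_digits B i)) \<le> (\<Sum>k\<in>B. nrm True (H True k i))"
        by (rule nrm_constant_le) (use B in auto)
      also have "\<dots> \<le> (\<Sum>k\<in>B. \<eta> / 2 * nrm False (H False k i))"
        by (rule sum_mono) (use B(1) in \<open>auto simp: R_def\<close>)
      also have "\<dots> = \<eta> / 2 * (\<Sum>k\<in>B. nrm False (H False k i))" by (simp add: sum_distrib_left)
      also have "\<dots> \<le> \<eta> / 2 * 2" using B(5) \<mu> \<eta> by (intro mult_left_mono) auto
      finally have "nrm False (vec False (constant_digits B i)) \<le> \<gamma> False / 2"
        using transfer[OF q] by simp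
      moreover have "\<gamma> False * 1 \<le> \<gamma> False * (\<Sum>k\<in>B. nrm False (H False k i))"
        using B(4) g0[of False] by (intro mult_left_mono) auto
      moreover have "\<gamma> False * (\<Sum>k\<in>B. nrm False (H False k i)) \<le> nrm False (vec False (constant_digits B i))"
        by (rule nrm_constant_ge) (use B in auto)
      ultimately show False using g0[of False] by linarith
    qed
    obtain B where B: "B \<subseteq> R" "finite B" "\<And>k. k \<in> B \<Longrightarrow> max p i \<le> k \<and> card B \<le> k"
        "\<mu> / 2 \<le> (\<Sum>k\<in>B. nrm False (H False k i))" "(\<Sum>k\<in>B. nrm False (H False k i)) \<le> \<mu> / 2 + \<mu> / 2"
      using greedy_subset[of R \<delta> "\<lambda>k. nrm False (H False k i)" "\<mu> / 2" "\<mu> / 2" "max p i"] R f \<delta>(1) \<mu>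
      by (auto simp: R_def)
    obtain q where q: "p < q" "digits_in (constant_digits B i) p q"
      using digits_in_constant[of B p i] B(2,3) by auto
    have "nrm False (vec False (constant_digits B i)) \<le> (\<Sum>k\<in>B. nrm False (H False k i))"
      by (rule nrm_constant_le) (use B in auto)
    then have upper: "nrm False (vec False (constant_digits B i)) \<le> \<mu>" using B(5) by simp
    have "c0 * \<mu> = \<gamma> True * (\<eta> / 2 * (\<mu> / 2))" by (simp add: c0_def)
    also have "\<dots> \<le> \<gamma> True * (\<eta> / 2 * (\<Sum>k\<in>B. nrm False (H False k i)))"
      using B(4) g0[of True] \<eta> by (intro mult_left_mono) auto
    also have "\<dots> = \<gamma> True * (\<Sum>k\<in>B. \<eta> / 2 * nrm False (H False k i))" by (simp add: sum_distrib_left)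
    also have "\<dots> \<le> \<gamma> True * (\<Sum>k\<in>B. nrm True (H True k i))"
      using g0[of True] B(1) by (intro mult_left_mono sum_mono) (auto simp: R_def)
    also have "\<dots> \<le> nrm True (vec True (constant_digits B i))"
      by (rule nrm_constant_ge) (use B in auto)
    finally show ?thesis using q upper by blast
  qed
  then show ?thesis using \<eta> g0[of True] by (intro that[of c0]) (auto simp: c0_def)
qed

text \<open>
  The outcome of \<open>n\<close> rounds of averaging that start from vectors of the kind found in \<open>base_step\<close>. Here \<open>\<mu>\<close> measures
  the total mass that has been distributed, \<open>\<rho> > \<gamma> False\<close> is the contraction factor in the second space,
  and \<open>p\<close> says how far out the vector lies. The bound on the number of test sets in \<open>spread_le\<close> is tied
  to \<open>p\<close>, so that a piece may be placed beyond the support of its predecessor.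
\<close>

definition averages :: "real \<Rightarrow> real \<Rightarrow> nat \<Rightarrow> real \<Rightarrow> nat \<Rightarrow> bool" where
  "averages c0 \<rho> n \<mu> p \<longleftrightarrow> (\<exists>d q. p < q \<and> digits_in d p q \<and>
     spread_le (\<gamma> False) (b p) (\<mu> * \<rho> ^ n / \<gamma> False) (vec False d) \<and>
     c0 * \<mu> * \<gamma> True ^ n \<le> nrm True (vec True d))"

text \<open>
  A mass \<open>\<mu>\<close> of any size is admitted here, because \<open>m\<close> can be chosen so large that \<open>\<mu> / m \<le> 1\<close>. The
  pieces start beyond \<open>m\<close>, which makes their supports an admissible family for the lower estimate.
\<close>

lemma averages_Suc:
  assumes \<rho>: "\<gamma> False < \<rho>" and IH: "\<And>\<mu> p. 0 < \<mu> \<Longrightarrow> \<mu> \<le> 1 \<Longrightarrow> averages c0 \<rho> n \<mu> p"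
    and \<mu>: "0 < \<mu>"
  shows "averages c0 \<rho> (Suc n) \<mu> p"
proof -
  define \<delta> where "\<delta> = \<rho> - \<gamma> False"
  have \<delta>: "0 < \<delta>" using \<rho> by (simp add: \<delta>_def)
  obtain m :: nat where m: "max 1 (max \<mu> (2 * b p / \<delta>)) \<le> m" using real_arch_simple by blast
  then have m0: "0 < m" and m\<mu>: "\<mu> \<le> m" and mb: "2 * real (b p) \<le> \<delta> * m"
    using \<delta> by (auto simp: field_simps)
  have m1: "0 < \<mu> / m" "\<mu> / m \<le> 1" using m0 m\<mu> \<mu> by auto
  define A where "A = \<mu> / m * \<rho> ^ n / \<gamma> False"
  have \<rho>0: "0 < \<rho>" using \<rho> g0[of False] by simp
  have A0: "0 \<le> A"
    unfolding A_def using m0 \<mu> \<rho>0 g0[of False] by (intro divide_nonneg_pos mult_nonneg_nonneg) auto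
  have "\<exists>d q. p < q \<and> digits_in d p q \<and> (spread_le (\<gamma> False) (b p) A (vec False d) \<and>
      c0 * (\<mu> / m) * \<gamma> True ^ n \<le> nrm True (vec True d))" for s :: nat and p
    using IH[OF m1, of p] unfolding averages_def A_def by blast
  then obtain ds N where N: "strict_mono N" and N0: "N 0 = p + m" and ds: "\<And>l. digits_in (ds l) (N l) (N (Suc l))"
    and P: "\<And>l. spread_le (\<gamma> False) (b (N l)) A (vec False (ds l)) \<and>
      c0 * (\<mu> / m) * \<gamma> True ^ n \<le> nrm True (vec True (ds l))"
    by (rule glue_sequence[where start = "p + m" and P = "\<lambda>s p d. spread_le (\<gamma> False) (b p) A (vec False d) \<and>
      c0 * (\<mu> / m) * \<gamma> True ^ n \<le> nrm True (vec True d)"]) (rule that)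
  define es where "es = (\<lambda>l. if l < m then ds l else (\<lambda>_. 0))"
  define d where "d = glue es"
  have es: "digits_in (es l) (N l) (N (Suc l))" for l using ds by (simp add: es_def digits_in_def)
  have d: "digits_in d (N 0) (N m)"
    unfolding digits_in_def
  proof (intro allI conjI impI)
    fix k
    show "d k \<le> k" unfolding d_def by (rule glue_le[OF N es])
    assume "d k \<noteq> 0"
    then obtain l where l: "N l \<le> k" "k < N (Suc l)" "d k = es l k"
      unfolding d_def by (rule glue_nonzero_block[OF N es])
    have "l < m" using l(3) \<open>d k \<noteq> 0\<close> by (simp add: es_def split: if_splits)
    then have "N (Suc l) \<le> N m" using N by (simp add: strict_mono_less_eq Suc_le_eq)
    moreover have "N 0 \<le> N l" using N by (simp add: strict_mono_less_eq)
    ultimately show "N 0 \<le> k" "k < N m" using l by linarith+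
  qed
  define c where "c = (\<lambda>l. b (N l))"
  have c: "strict_mono c" using b N by (simp add: strict_mono_def c_def)
  have block: "proj {c l..<c (Suc l)} (vec x d) = vec x (ds l)" if "l < m" for x l
    using proj_vec_glue[OF N es, of l x] that by (simp add: c_def d_def es_def)
  have m_le: "m \<le> c l" for l
  proof -
    have "N 0 \<le> N l" using N by (simp add: strict_mono_less_eq)
    then have "m \<le> N l" using N0 by simp
    then show ?thesis using b_ge[of "N l"] by (simp add: c_def)
  qed
  have "spread_le (\<gamma> False) (b p) (A * m * (\<gamma> False + \<delta>)) (vec False d)"
  proof (rule spread_le_average[OF g c _ vec_c00[OF d], where m = m])
    show "1 \<le> c 0" using m_le[of 0] m0 by simp
    show "c 0 \<le> j \<and> j < c m" if "vec False d j \<noteq> 0" for j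
      using vec_support[OF d that] by (simp add: c_def)
    show "spread_le (\<gamma> False) (c l) A (proj {c l..<c (Suc l)} (vec False d))" if "l < m" for l
      using P[of l] unfolding block[OF that] by (simp add: c_def)
  qed (use A0 mb in auto)
  moreover have "A * m * (\<gamma> False + \<delta>) = \<mu> * \<rho> ^ Suc n / \<gamma> False"
    using m0 by (simp add: A_def \<delta>_def)
  moreover have "c0 * \<mu> * \<gamma> True ^ Suc n \<le> nrm True (vec True d)"
  proof -
    have "c0 * \<mu> * \<gamma> True ^ Suc n = \<gamma> True * (\<Sum>l<m. c0 * (\<mu> / m) * \<gamma> True ^ n)"
      using m0 by simp
    also have "\<dots> \<le> \<gamma> True * (\<Sum>l\<in>{..<m}. nrm True (proj {c l..<c (Suc l)} (vec True d)))"
      using P block g0[of True] by (intro mult_left_mono sum_mono) auto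
    also have "\<dots> \<le> nrm True (vec True d)"
    proof (rule tnorm_successive_le[OF g vec_c00[OF d]])
      show "successive {..<m} (\<lambda>l. {c l..<c (Suc l)})"
        by (rule successive_intervals) (rule c)
      show "card {..<m} \<le> a" if "j \<in> {..<m}" "a \<in> {c j..<c (Suc j)}" for j a
        using m_le[of j] that by simp
    qed simp
    finally show ?thesis .
  qed
  moreover have "p < N m" "digits_in d p (N m)"
  proof -
    have "p < N 0" using N0 m0 by simp
    moreover have "N 0 \<le> N m" using N by (simp add: strict_mono_less_eq)
    ultimately show "p < N m" "digits_in d p (N m)" using digits_in_mono[OF d] by auto
  qed
  ultimately show ?thesis unfolding averages_def by metis
qed

text \<open>
  The upper bound after \<open>n\<close> rounds falls short of the lower one by a factor of order \<open>(\<rho> / \<gamma> True)\<^sup>n\<close>, so a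
  mass can be chosen for which the vector has norm at least \<open>1\<close> in the first space and arbitrarily small
  norm in the second.
\<close>

lemma parameters_not_less: "\<not> \<gamma> False < \<gamma> True"
proof
  assume less: "\<gamma> False < \<gamma> True"
  define \<rho> where "\<rho> = (\<gamma> False + \<gamma> True) / 2"
  have \<rho>: "\<gamma> False < \<rho>" "\<rho> < \<gamma> True" using less by (simp_all add: \<rho>_def)
  obtain c0 where c0: "0 < c0" and base: "\<And>\<mu> p. 0 < \<mu> \<Longrightarrow> \<mu> \<le> 1 \<Longrightarrow>
     \<exists>d q. p < q \<and> digits_in d p q \<and> nrm False (vec False d) \<le> \<mu> \<and> c0 * \<mu> \<le> nrm True (vec True d)"
    using base_step by blast
  have "averages c0 \<rho> 0 \<mu> p" if \<mu>: "0 < \<mu>" "\<mu> \<le> 1" for \<mu> p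
  proof -
    obtain d q where d: "p < q" "digits_in d p q" "nrm False (vec False d) \<le> \<mu>" "c0 * \<mu> \<le> nrm True (vec True d)"
      using base[OF \<mu>] by blast
    have "spread_le (\<gamma> False) (b p) (\<mu> / \<gamma> False) (vec False d)"
    proof (rule spread_le_far[OF g vec_c00[OF d(2)] _ d(3)])
      show "vec False d j = 0" if "j < b p" for j using vec_support[OF d(2), of False j] that by fastforce
    qed
    then show ?thesis using d unfolding averages_def by auto
  qed
  then have small: "averages c0 \<rho> n \<mu> p" if "0 < \<mu>" "\<mu> \<le> 1" for n \<mu> p
    using that by (induction n arbitrary: \<mu> p) (auto intro: averages_Suc[OF \<rho>(1)])
  have avg: "averages c0 \<rho> (Suc n) \<mu> p" if "0 < \<mu>" for n \<mu> p
    by (rule averages_Suc[OF \<rho>(1) small that])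
  obtain \<eta> p where \<eta>: "0 < \<eta>"
    and transfer: "\<And>d q. digits_in d p q \<Longrightarrow> nrm False (vec False d) \<le> \<eta> \<Longrightarrow> nrm True (vec True d) \<le> 1 / 2"
    using uniform_transfer[of "1 / 2" False True] by (metis half_gt_zero zero_less_one)
  have "0 < \<rho>" "0 < \<gamma> True" "0 < \<gamma> False" using \<rho> g0 by (auto intro: less_trans)
  then have "0 < \<rho> / \<gamma> True" "\<rho> / \<gamma> True < 1" using \<rho> by auto
  then obtain n where n: "(\<rho> / \<gamma> True) ^ n < \<eta> * c0 * \<gamma> False"
    using real_arch_pow_inv[of "\<eta> * c0 * \<gamma> False" "\<rho> / \<gamma> True"] \<eta> c0 \<open>0 < \<gamma> False\<close> by auto
  (* This mass makes the norm in the first space at least 1. *)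
  define \<mu> where "\<mu> = 1 / (c0 * \<gamma> True ^ Suc n)"
  have \<mu>: "0 < \<mu>" using c0 \<open>0 < \<gamma> True\<close> by (simp add: \<mu>_def)
  obtain d q where d: "digits_in d (Suc p) q"
    "spread_le (\<gamma> False) (b (Suc p)) (\<mu> * \<rho> ^ Suc n / \<gamma> False) (vec False d)"
    "c0 * \<mu> * \<gamma> True ^ Suc n \<le> nrm True (vec True d)"
    using avg[OF \<mu>, of n "Suc p"] unfolding averages_def by blast
  have "1 \<le> b (Suc p)" using b_ge[of "Suc p"] by simp
  then have "nrm False (vec False d) \<le> \<mu> * \<rho> ^ Suc n / \<gamma> False" by (rule spread_le_norm[OF d(2)])
  also have "\<dots> = (\<rho> / \<gamma> True) ^ Suc n / (c0 * \<gamma> False)" by (simp add: \<mu>_def power_divide)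
  also have "\<dots> \<le> (\<rho> / \<gamma> True) ^ n / (c0 * \<gamma> False)"
    using \<open>0 < \<rho> / \<gamma> True\<close> \<open>\<rho> / \<gamma> True < 1\<close> c0 \<open>0 < \<gamma> False\<close>
    by (intro divide_right_mono power_decreasing) auto
  also have "\<dots> \<le> \<eta>"
  proof -
    have "0 < c0 * \<gamma> False" using c0 \<open>0 < \<gamma> False\<close> by simp
    then show ?thesis using n by (simp add: pos_divide_le_eq mult.assoc del: power_divide)
  qed
  finally have "nrm True (vec True d) \<le> 1 / 2"
    using transfer[of d q] digits_in_mono[OF d(1), of p q] by simp
  moreover have "c0 * \<mu> * \<gamma> True ^ Suc n = 1" using c0 \<open>0 < \<gamma> True\<close> by (simp add: \<mu>_def)
  ultimately show False using d(3) by simp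
qed

end

section \<open>Incompatibility\<close>

text \<open>
  The relation of \<open>x\<close> enters through three facts: changing finitely many coefficients, or changing
  them by a sequence that makes the series absolutely convergent, leads to an equivalent sequence,
  whereas changing infinitely many coefficients \<open>a\<^sub>k\<close> by \<open>c / \<parallel>x\<^sub>k\<parallel>\<close> with a fixed \<open>c > 0\<close>
  never does, since the terms of the series of differences do not tend to \<open>0\<close>. Dividing by \<open>\<parallel>x\<^sub>k\<parallel>\<close> is possible because the members of a basic sequence do not vanish.
\<close>

lemma borel_reducible_schauder_incompatible:
  fixes X :: "'a::banach set" and \<gamma> :: "bool \<Rightarrow> real"
  assumes X: "banach_subspace X" and x: "basic_sequence X x"
    and g: "\<And>c. \<gamma> c \<in> {0<..<1}"
    and red: "\<And>c. schauder_er X x \<le>\<^sub>B schauder_er (T_space (\<gamma> c)) (t_vec (\<gamma> c))"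
  shows "\<not> \<gamma> False < \<gamma> True"
proof -
  have sub: "subspace X" "closed X" using X by (auto simp: banach_subspace_def)
  have xX: "x k \<in> X" for k using x by (auto simp: basic_sequence_def)
  have x_nz: "x k \<noteq> 0" for k
  proof
    assume 0: "x k = 0"
    have ex1: "\<exists>!a :: nat \<Rightarrow> real. (\<lambda>n. a n *\<^sub>R x n) sums 0"
    proof -
      have "0 \<in> closure (span (range x))" using closure_subset span_zero by blast
      then show ?thesis using x by (auto simp: basic_sequence_def schauder_basis_def)
    qed
    have uniq: "a = a'" if "(\<lambda>n. a n *\<^sub>R x n) sums 0" "(\<lambda>n. a' n *\<^sub>R x n) sums 0" for a a'
      using the1_equality[OF ex1, OF that(1)] the1_equality[OF ex1, OF that(2)] by simp
    have "(\<lambda>n. (\<lambda>_. 0) n *\<^sub>R x n) sums 0" by simp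
    moreover have "(\<lambda>n. (if n = k then 1 else 0) *\<^sub>R x n) sums 0"
    proof -
      have "(\<lambda>n. (if n = k then 1 else 0) *\<^sub>R x n) = (\<lambda>_. 0)" using 0 by auto
      then show ?thesis by simp
    qed
    ultimately have "(\<lambda>_. 0) = (\<lambda>n. if n = k then 1 else 0 :: real)" by (rule uniq)
    from fun_cong[OF this, of k] show False by simp
  qed
  have coef_iff: "a \<in> coef X x \<longleftrightarrow> summable (\<lambda>n. a n *\<^sub>R x n)" for a
  proof
    assume "summable (\<lambda>n. a n *\<^sub>R x n)"
    then obtain z where z: "(\<lambda>n. a n *\<^sub>R x n) sums z" by (auto simp: summable_def)
    have "(\<Sum>n<m. a n *\<^sub>R x n) \<in> X" for m
      using sub(1) xX by (intro subspace_sum subspace_scale) auto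
    then have "z \<in> X"
      using z closed_sequentially[OF sub(2), of "\<lambda>m. \<Sum>n<m. a n *\<^sub>R x n" z] by (simp add: sums_def)
    then show "a \<in> coef X x" using z by (auto simp: coef_def)
  qed (auto simp: coef_def summable_def)

  have "\<exists>\<theta>. \<theta> \<in> borel_measurable borel \<and> (\<forall>u v. (u, v) \<in> schauder_er X x \<longleftrightarrow>
      (\<theta> u, \<theta> v) \<in> schauder_er (T_space (\<gamma> c)) (t_vec (\<gamma> c)))" for c
    using red[of c] unfolding borel_reducible_def by blast
  then obtain \<theta>0 :: "bool \<Rightarrow> (nat \<Rightarrow> real) \<Rightarrow> nat \<Rightarrow> real" where \<theta>0: "\<And>c. \<theta>0 c \<in> borel_measurable borel"
    "\<And>c u v. (u, v) \<in> schauder_er X x \<longleftrightarrow>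
      (\<theta>0 c u, \<theta>0 c v) \<in> schauder_er (T_space (\<gamma> c)) (t_vec (\<gamma> c))" by metis

  define digit where "digit = (\<lambda>i::nat. if i = 0 then 0 else (1/2::real) ^ i)"
  define \<phi> where "\<phi> = (\<lambda>(d :: nat \<Rightarrow> nat) k. digit (d k) / norm (x k))"
  have "continuous_on UNIV \<phi>"
  proof (rule continuous_on_coordinatewise_then_product)
    fix k
    have "continuous_on UNIV (\<lambda>i. digit i / norm (x k))"
      by (simp add: continuous_on_open_vimage Topological_Spaces.open_discrete)
    then show "continuous_on UNIV (\<lambda>d. \<phi> d k)"
      unfolding \<phi>_def by (rule continuous_on_compose2) (auto intro: continuous_on_product_coordinates)
  qed
  then have \<phi>: "\<phi> \<in> borel_measurable borel" by (rule borel_measurable_continuous_onI)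
  define \<theta> where "\<theta> = (\<lambda>c d. \<theta>0 c (\<phi> d))"
  define R where "R = (\<lambda>d e. summable (\<lambda>k. (\<phi> d k - \<phi> e k) *\<^sub>R x k))"
  have R_iff: "tail_cauchy (\<gamma> c) (\<lambda>j. \<theta> c d j - \<theta> c e j) \<longleftrightarrow> R d e" for c d e
    using \<theta>0(2)[of "\<phi> d" "\<phi> e" c] by (simp add: schauder_er_def coef_iff coef_T_iff[OF g] \<theta>_def R_def)
  have meas: "\<theta> c \<in> borel_measurable borel" for c
    unfolding \<theta>_def by (rule measurable_compose[OF \<phi> \<theta>0(1)])
  have fin: "tail_cauchy (\<gamma> c) (\<lambda>j. \<theta> c d j - \<theta> c e j)" if "finite {i. d i \<noteq> e i}" for c d e
    unfolding R_iff R_def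
    by (rule summable_finite[OF that]) (simp add: \<phi>_def)
  obtain n b D where nbD: "strict_mono n \<and> strict_mono b \<and> (\<forall>d k. D d (n k) = d k) \<and>
    (\<forall>d d' i. i \<notin> range n \<longrightarrow> D d i = D d' i) \<and>
    (\<forall>c d k. (\<forall>i. d i \<le> i) \<longrightarrow> tnorm (\<gamma> c) (proj {b k..<b (Suc k)}
       (\<lambda>j. \<theta> c (D d) j - \<theta> c (D (\<lambda>i. if i = k then d k else 0)) j)) \<le> 4 * (1/2) ^ k)"
    by (atomize_elim, rule additive_reduction[OF g meas fin])
  have n: "strict_mono n" and b: "strict_mono b" using nbD by blast+
  have D: "D d (n k) = d k" "i \<notin> range n \<Longrightarrow> D d i = D d' i" for d d' k i
    using nbD by blast+
  have err: "tnorm (\<gamma> c) (proj {b k..<b (Suc k)}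
       (\<lambda>j. \<theta> c (D d) j - \<theta> c (D (\<lambda>i. if i = k then d k else 0)) j)) \<le> 4 * (1/2) ^ k"
    if "\<And>i. d i \<le> i" for c d k
    using nbD that by blast
  define z where "z = D (\<lambda>_. 0)"
  define H where "H = (\<lambda>c k i. proj {b k..<b (Suc k)} (\<lambda>j. \<theta> c (D (\<lambda>i'. if i' = k then i else 0)) j - \<theta> c z j))"
  have H_supp: "b k \<le> j \<and> j < b (Suc k)" if "H c k i j \<noteq> 0" for c k i j
    using that by (auto simp: H_def proj_def split: if_splits)
  have H_in_block: "H c k i j = \<theta> c (D (\<lambda>i'. if i' = k then i else 0)) j - \<theta> c z j"
    if "b k \<le> j" "j < b (Suc k)" for c k i j
    using that by (simp add: H_def proj_def)
  have H_zero: "H c k 0 j = 0" for c k j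
    by (simp add: H_def proj_def z_def)
  have blk: "block_sum (H c) d j = H c k (d k) j" if "b k \<le> j" "j < b (Suc k)" for c d k j
    by (rule block_sum_in_block[OF b _ that]) (rule H_supp)
  (* The two sides differ by a sequence with summable blocks, by the additivity of the reductions. *)
  have key: "tail_cauchy (\<gamma> c) (block_sum (H c) d) \<longleftrightarrow> R (D d) z" if d: "\<And>i. d i \<le> i" for c d
  proof -
    define e where "e = (\<lambda>j. (\<theta> c (D d) j - \<theta> c z j) - block_sum (H c) d j)"
    have e: "tail_cauchy (\<gamma> c) e"
    proof (rule tail_cauchy_blocks[OF g b])
      show "summable (\<lambda>k. 4 * (1/2 :: real) ^ k)" by (intro summable_mult summable_geometric) simp
      fix k
      have "proj {b k..<b (Suc k)} e = proj {b k..<b (Suc k)}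
         (\<lambda>j. \<theta> c (D d) j - \<theta> c (D (\<lambda>i. if i = k then d k else 0)) j)"
      proof
        fix j
        show "proj {b k..<b (Suc k)} e j = proj {b k..<b (Suc k)}
            (\<lambda>j. \<theta> c (D d) j - \<theta> c (D (\<lambda>i. if i = k then d k else 0)) j) j"
          using blk[of k j c d] H_in_block[of k j c "d k"] by (simp add: proj_def e_def)
      qed
      then show "tnorm (\<gamma> c) (proj {b k..<b (Suc k)} e) \<le> 4 * (1/2) ^ k" using err[OF d] by simp
    qed
    show ?thesis
      unfolding R_iff[of c "D d" z, symmetric]
    proof
      assume "tail_cauchy (\<gamma> c) (block_sum (H c) d)"
      from tail_cauchy_add[OF g e this] show "tail_cauchy (\<gamma> c) (\<lambda>j. \<theta> c (D d) j - \<theta> c z j)"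
        by (simp add: e_def)
    next
      assume "tail_cauchy (\<gamma> c) (\<lambda>j. \<theta> c (D d) j - \<theta> c z j)"
      from tail_cauchy_add[OF g tail_cauchy_minus[OF g e] this] show "tail_cauchy (\<gamma> c) (block_sum (H c) d)"
        by (simp add: e_def)
    qed
  qed
  have norm_term: "norm ((\<phi> (D d) i - \<phi> z i) *\<^sub>R x i) = digit (D d i - z i)" for d i
  proof (cases "i \<in> range n")
    case True
    then obtain k where "i = n k" by blast
    then show ?thesis using x_nz[of i] by (simp add: z_def D(1) \<phi>_def digit_def)
  next
    case False
    then have "D d i = z i" unfolding z_def by (rule D(2))
    then show ?thesis by (simp add: \<phi>_def digit_def)
  qed
  interpret block_system \<gamma> H b
  proof
    fix d :: "nat \<Rightarrow> nat" assume d: "\<And>k. d k \<le> k"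
    show "tail_cauchy (\<gamma> True) (block_sum (H True) d) \<longleftrightarrow> tail_cauchy (\<gamma> False) (block_sum (H False) d)"
      using key[OF d] by simp
  next
    fix d :: "nat \<Rightarrow> nat" and i :: nat assume d: "\<And>k. d k \<le> k" and i: "1 \<le> i" "infinite {k. d k = i}"
    show "\<not> tail_cauchy (\<gamma> False) (block_sum (H False) d)"
      unfolding key[OF d]
    proof
      assume "R (D d) z"
      then have "(\<lambda>k. digit (D d k - z k)) \<longlonglongrightarrow> 0"
        unfolding R_def norm_term[symmetric] by (intro tendsto_norm_zero summable_LIMSEQ_zero)
      then have "(\<lambda>k. digit (D d (n k) - z (n k))) \<longlonglongrightarrow> 0"
        using LIMSEQ_subseq_LIMSEQ[OF _ n] by (auto simp: o_def)
      then have "(\<lambda>k. digit (d k)) \<longlonglongrightarrow> 0" by (simp add: z_def D(1))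
      moreover have "0 < digit i" using i by (simp add: digit_def)
      ultimately have "\<forall>\<^sub>F k in sequentially. digit (d k) < digit i" by (rule order_tendstoD(2))
      then obtain K where "\<And>k. K \<le> k \<Longrightarrow> digit (d k) < digit i" by (auto simp: eventually_sequentially)
      moreover obtain k where "K \<le> k" "d k = i" using i(2) unfolding infinite_nat_iff_unbounded_le by blast
      ultimately show False by blast
    qed
  next
    fix d :: "nat \<Rightarrow> nat" assume d: "\<And>k. d k \<le> k" and inj: "inj_on d {k. d k \<noteq> 0}"
    define t where "t = (\<lambda>i. D d i - z i)"
    have t_nz: "\<exists>k. i = n k \<and> t i = d k" if "t i \<noteq> 0" for i
    proof (cases "i \<in> range n")
      case False
      then have "D d i = z i" unfolding z_def by (rule D(2))
      then show ?thesis using that by (simp add: t_def)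
    qed (auto simp: t_def z_def D(1))
    have inj_t: "inj_on t {i. t i \<noteq> 0}"
    proof (rule inj_onI)
      fix i i' assume *: "i \<in> {i. t i \<noteq> 0}" "i' \<in> {i. t i \<noteq> 0}" "t i = t i'"
      obtain k k' where k: "i = n k" "t i = d k" "i' = n k'" "t i' = d k'" using * t_nz by blast
      then have "k = k'" using * inj by (auto dest: inj_onD)
      then show "i = i'" using k by simp
    qed
    have "summable (\<lambda>i. digit (t i))"
    proof (rule summableI_nonneg_bounded)
      show "0 \<le> digit (t i)" for i by (simp add: digit_def)
      fix m
      have half: "(\<Sum>i\<in>I. (1/2 :: real) ^ i) \<le> 2" if "finite I" for I
        using sum_le_suminf[of "\<lambda>i. (1/2 :: real) ^ i" I] that suminf_geometric[of "1/2 :: real"] summable_geometric[of "1/2 :: real"]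
        by simp
      have "(\<Sum>i<m. digit (t i)) = (\<Sum>i\<in>{i. i < m \<and> t i \<noteq> 0}. digit (t i))"
        by (rule sum.mono_neutral_right) (auto simp: digit_def)
      also have "\<dots> = (\<Sum>i\<in>{i. i < m \<and> t i \<noteq> 0}. (1/2) ^ t i)"
        by (rule sum.cong) (auto simp: digit_def)
      also have "\<dots> = (\<Sum>i\<in>t ` {i. i < m \<and> t i \<noteq> 0}. (1/2) ^ i)"
        by (subst sum.reindex) (auto intro: inj_on_subset[OF inj_t])
      also have "\<dots> \<le> 2" by (rule half) simp
      finally show "(\<Sum>i<m. digit (t i)) \<le> 2" .
    qed
    then have "R (D d) z"
      unfolding R_def t_def by - (rule summable_norm_cancel, simp only: norm_term)
    then show "tail_cauchy (\<gamma> False) (block_sum (H False) d)" unfolding key[OF d] .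
  qed (use g b H_supp H_zero in auto)
  show ?thesis by (rule parameters_not_less)
qed

text \<open>
  The assumptions on the two spaces are symmetric, so the lemma excludes either order of the
  parameters.
\<close>

theorem theorem1p4:
  fixes \<alpha> \<beta> :: real
  assumes "0 < \<alpha>" "\<alpha> < 1" "0 < \<beta>" "\<beta> < 1" "\<alpha> \<noteq> \<beta>"
  shows "incompatible (schauder_ers TYPE('a::banach))
    (schauder_er (T_space \<alpha>) (t_vec \<alpha>)) (schauder_er (T_space \<beta>) (t_vec \<beta>))"
proof
  assume "compatible (schauder_ers TYPE('a)) (schauder_er (T_space \<alpha>) (t_vec \<alpha>)) (schauder_er (T_space \<beta>) (t_vec \<beta>))"
  then obtain X :: "'a set" and x where X: "banach_subspace X" "basic_sequence X x"
    and red: "schauder_er X x \<le>\<^sub>B schauder_er (T_space \<alpha>) (t_vec \<alpha>)"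
      "schauder_er X x \<le>\<^sub>B schauder_er (T_space \<beta>) (t_vec \<beta>)"
    unfolding compatible_def schauder_ers_def by blast
  have "\<not> \<beta> < \<alpha>"
    using borel_reducible_schauder_incompatible[OF X, of "\<lambda>c. if c then \<alpha> else \<beta>"] red assms by simp
  moreover have "\<not> \<alpha> < \<beta>"
    using borel_reducible_schauder_incompatible[OF X, of "\<lambda>c. if c then \<beta> else \<alpha>"] red assms by simp
  ultimately show False using assms(5) by simp
qed

end
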